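(* Suppose $p=b$ and $4+\frac{1200}{\rho}\le d\le b^{1-\rho}$ for some constant $\rho\in(0,1)$ independent of $b$. Then there exist constants $\delta=\delta(\rho)>0$ and $\theta=\theta(\rho)\in(0,1)$ such that, when $d_{\mathrm{in}}=\lfloor\theta d\rfloor$ and $d_{\mathrm{out}}=d-\lfloor\theta d\rfloor$, with probability $1-o(1)$ over the choice of $B\sim\mathcal{G}(b,p,d_{\mathrm{in}},d_{\mathrm{out}})$ the following holds for every configuration $\tau$ on $\partial P$: $$\mu_{\mathbb{B}}\Big(\bigcup_{i\in[q]}\{\sigma^i(B)\}\ \Big|\ \partial P=\tau\Big)\ge\Big(1-\frac{q^2e^{2h}}{e^{\delta\beta_Bd}}\Big)^{2b}.$$
   Context: Random graph $\mathcal{G}(b,p,d_{\mathrm{in}},d_{\mathrm{out}})$ (integers $b\ge p$, $d=d_{\mathrm{in}}+d_{\mathrm{out}}\ge3$): take vertex set $V_B=L\cup R$ with $|L|=|R|=b$ disjoint; choose a uniformly random set of ports $P\subseteq V_B$ with $|P\cap L|=|P\cap R|=p$; take $d_{\mathrm{in}}$ independent uniformly random perfect matchings between $L$ and $R$ and $d_{\mathrm{out}}$ independent uniformly random perfect matchings between $L\setminus P$ and $R\setminus P$; $E_B$ is the union of these matchings with multiple edges replaced by single edges. Let $B=(V_B,E_B)$ be an induced subgraph of a larger graph $\mathbb{B}=(V_{\mathbb{B}},E_{\mathbb{B}})$, with $\partial P=V_{\mathbb{B}}\setminus V_B$, where each port is adjacent to at most $d_{\mathrm{out}}$ vertices of $\partial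 P$ and no vertex of $V_B\setminus P$ is adjacent to $\partial P$. Consider the $q$-state Potts model on $\mathbb{B}$ (Gibbs distribution $\mu_{\mathbb{B}}(\sigma)\propto\exp(\sum_{\{u,v\}\in E_{\mathbb{B}}}\beta_{\mathbb{B}}(\{u,v\})\mathbb{1}(\sigma(u)=\sigma(v))+\sum_vh_{\mathbb{B}}(v,\sigma(v)))$) where $\beta_{\mathbb{B}}(e)=\beta_B>0$ for $e\in E_B$, $|\beta_{\mathbb{B}}(e)|\le\beta_B$ for $e\in E_{\mathbb{B}}\setminus E_B$, and $h_{\mathbb{B}}(v,i)=h\cdot\mathbb{1}(i=\kappa)\mathbb{1}(v\in V_B)$ for some $\kappa\in[q]$, $h\in\mathbb{R}$. $\sigma^i(B)$ is the configuration of $V_B$ with all vertices assigned spin $i$, and $\{\partial P=\tau\}$ is the event that the configuration on $\partial P$ equals $\tau\in[q]^{\partial P}$. $o(1)$ is as $b\to\infty$.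
   Formalization: The bound is proved with e^{2|h|} in place of e^{2h} (the printed form fails for very negative h), and only when 1 − q²e^{2|h|}/e^{δβ_B d} ≥ 0 (otherwise the even power 2b can make the right side exceed 1). *)

theory Defs
  imports "HOL-Probability.Probability"
begin

text \<open>
  Graphs are simple and undirected: a vertex set together with a set of two-element vertex sets.
  Edge sets being sets, a union of matchings merges parallel edges.
\<close>

definition perfect_matchings :: "'a set \<Rightarrow> 'a set \<Rightarrow> 'a set set set" where
  "perfect_matchings A B =
     {M. M \<subseteq> {{u, v} | u v. u \<in> A \<and> v \<in> B} \<and> (\<forall>x \<in> A \<union> B. \<exists>!e. e \<in> M \<and> x \<in> e)}"

definition port_sets :: "'a set \<Rightarrow> 'a set \<Rightarrow> nat \<Rightarrow> 'a set set" where
  "port_sets L R p = {P. P \<subseteq> L \<union> R \<and> card (P \<inter> L) = p \<and> card (P \<inter> R) = p}"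

text \<open>
  The joint law of the port set and the edge set of \<open>\<G>(b, p, d\<^sub>i\<^sub>n, d\<^sub>o\<^sub>u\<^sub>t)\<close> on the two
  sides \<open>L\<close> and \<open>R\<close>; it is intended for disjoint \<open>L\<close>, \<open>R\<close> with \<open>card L = card R = b \<ge> p\<close>.
\<close>

definition random_port_graph ::
    "'a set \<Rightarrow> 'a set \<Rightarrow> nat \<Rightarrow> nat \<Rightarrow> nat \<Rightarrow> ('a set \<times> 'a set set) pmf" where
  "random_port_graph L R p d_in d_out =
     do {
       P \<leftarrow> pmf_of_set (port_sets L R p);
       M \<leftarrow> Pi_pmf {..<d_in} {} (\<lambda>_. pmf_of_set (perfect_matchings L R));
       N \<leftarrow> Pi_pmf {..<d_out} {} (\<lambda>_. pmf_of_set (perfect_matchings (L - P) (R - P)));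
       return_pmf (P, (\<Union>k<d_in. M k) \<union> (\<Union>k<d_out. N k))
     }"

definition simple_graph :: "'a set \<Rightarrow> 'a set set \<Rightarrow> bool" where
  "simple_graph V E \<longleftrightarrow> finite V \<and> E \<subseteq> {{u, v} | u v. u \<in> V \<and> v \<in> V \<and> u \<noteq> v}"

definition induced_subgraph :: "'a set \<Rightarrow> 'a set set \<Rightarrow> 'a set \<Rightarrow> 'a set set \<Rightarrow> bool" where
  "induced_subgraph V_B E_B V E \<longleftrightarrow> V_B \<subseteq> V \<and> E_B = {e \<in> E. e \<subseteq> V_B}"

definition attached_via_ports ::
    "'a set \<Rightarrow> 'a set set \<Rightarrow> 'a set \<Rightarrow> nat \<Rightarrow> 'a set \<Rightarrow> 'a set set \<Rightarrow> bool" where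
  "attached_via_ports V_B E_B P d_out V E \<longleftrightarrow>
     simple_graph V E \<and> induced_subgraph V_B E_B V E \<and>
     (\<forall>v \<in> P. card {u \<in> V - V_B. {u, v} \<in> E} \<le> d_out) \<and>
     (\<forall>v \<in> V_B - P. \<forall>u \<in> V - V_B. {u, v} \<notin> E)"

definition configs :: "'a set \<Rightarrow> nat \<Rightarrow> ('a \<Rightarrow> nat) set" where
  "configs V q = V \<rightarrow>\<^sub>E {1..q}"

definition potts_weight ::
    "'a set \<Rightarrow> 'a set set \<Rightarrow> ('a set \<Rightarrow> real) \<Rightarrow> ('a \<Rightarrow> nat \<Rightarrow> real) \<Rightarrow> ('a \<Rightarrow> nat) \<Rightarrow> real" where
  "potts_weight V E \<beta> h \<sigma> =
     exp ((\<Sum>e\<in>E. \<beta> e * of_bool (\<forall>u\<in>e. \<forall>v\<in>e. \<sigma> u = \<sigma> v)) + (\<Sum>v\<in>V. h v (\<sigma> v)))"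

definition potts_Z ::
    "nat \<Rightarrow> 'a set \<Rightarrow> 'a set set \<Rightarrow> ('a set \<Rightarrow> real) \<Rightarrow> ('a \<Rightarrow> nat \<Rightarrow> real) \<Rightarrow> real" where
  "potts_Z q V E \<beta> h = (\<Sum>\<sigma>\<in>configs V q. potts_weight V E \<beta> h \<sigma>)"

definition potts ::
    "nat \<Rightarrow> 'a set \<Rightarrow> 'a set set \<Rightarrow> ('a set \<Rightarrow> real) \<Rightarrow> ('a \<Rightarrow> nat \<Rightarrow> real) \<Rightarrow> ('a \<Rightarrow> nat) pmf" where
  "potts q V E \<beta> h =
     embed_pmf (\<lambda>\<sigma>. if \<sigma> \<in> configs V q then potts_weight V E \<beta> h \<sigma> / potts_Z q V E \<beta> h else 0)"

lemma finite_configs: "finite V \<Longrightarrow> finite (configs V q)"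
  by (simp add: configs_def finite_PiE)

lemma potts_Z_pos:
  assumes "finite V" "q \<ge> 1"
  shows "potts_Z q V E \<beta> h > 0"
  unfolding potts_Z_def
proof (rule sum_pos)
  show "configs V q \<noteq> {}"
    using assms by (simp add: configs_def PiE_eq_empty_iff)
qed (use assms in \<open>simp_all add: finite_configs potts_weight_def\<close>)

lemma pmf_potts:
  assumes "finite V" "q \<ge> 1"
  shows "pmf (potts q V E \<beta> h) \<sigma> =
           (if \<sigma> \<in> configs V q then potts_weight V E \<beta> h \<sigma> / potts_Z q V E \<beta> h else 0)"
  unfolding potts_def
proof (rule pmf_embed_pmf)
  let ?f = "\<lambda>\<sigma>. if \<sigma> \<in> configs V q then potts_weight V E \<beta> h \<sigma> / potts_Z q V E \<beta> h else 0"
  have Z: "potts_Z q V E \<beta> h > 0" using potts_Z_pos[OF assms] .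
  show nonneg: "0 \<le> ?f x" for x
    using Z by (simp add: potts_weight_def)
  have "(\<integral>\<^sup>+x. ennreal (?f x) \<partial>count_space UNIV) = (\<Sum>x\<in>configs V q. ennreal (?f x))"
    by (rule nn_integral_count_space'[OF finite_configs[OF assms(1)]]) auto
  also have "\<dots> = ennreal (\<Sum>x\<in>configs V q. ?f x)"
    by (rule sum_ennreal) (use nonneg in blast)
  also have "(\<Sum>x\<in>configs V q. ?f x) = 1"
    using Z by (simp add: potts_Z_def flip: sum_divide_distrib)
  finally show "(\<integral>\<^sup>+x. ennreal (?f x) \<partial>count_space UNIV) = 1" by simp
qed

definition mono_config :: "'a set \<Rightarrow> nat \<Rightarrow> 'a \<Rightarrow> nat" where
  "mono_config V_B i = (\<lambda>v\<in>V_B. i)"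

end

theory Submission
  imports Defs "HOL-Real_Asymp.Real_Asymp"
begin

text \<open>
  For \<open>p = b\<close> every vertex is a port, so \<open>B\<close> is the union of \<open>n = d_in\<close> uniform perfect matchings.
  It expands: every \<open>S\<close> with \<open>card S \<le> b\<close> has at least \<open>n * card S / 50\<close> boundary edges, even
  though parallel edges are merged. Indeed, let \<open>A\<close> and \<open>B\<close> be the parts of \<open>S\<close> on the two sides, with
  \<open>card B \<le> card A\<close>, and reveal in each matching the partners of half of the vertices of \<open>A\<close>, one
  at a time. Whatever was revealed before, the next edge fails to be a new boundary edge with
  probability at most \<open>(card B + n) / (b - card A / 2)\<close>: its end has to lie in \<open>B\<close> or among
  the at most \<open>n\<close> earlier neighbours. This bounds the exponential moment of the number of boundary
  edges, and Markov's inequality leaves enough room for a union bound over \<open>S\<close>.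

  Given expansion, a configuration \<open>\<sigma>\<close> whose most frequent spin on \<open>V_B\<close> is \<open>i\<close> and which has \<open>k\<close>
  vertices of other spins has at least \<open>n * k / 100\<close> bichromatic edges in \<open>B\<close>, whereas recolouring
  these \<open>k\<close> vertices with \<open>i\<close> affects at most \<open>k * d_out\<close> outer edges. For \<open>\<theta>\<close> close to 1 the
  weight of \<open>\<sigma>\<close> is therefore at most \<open>y ^ k\<close> times that of the monochromatic configuration,
  where \<open>y = exp (\<bar>h\<bar> - \<delta> * \<beta>_B * d)\<close>. Summing over \<open>\<sigma>\<close>, the partition function is at most
  \<open>(1 + q * y) ^ (2 * b)\<close> times the total monochromatic weight.
\<close>

section \<open>Uniform perfect matchings\<close>

lemma perfect_matchings_commute: "perfect_matchings A B = perfect_matchings B A"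
proof -
  have "{{u, v} | u v. u \<in> A \<and> v \<in> B} = {{u, v} | u v. u \<in> B \<and> v \<in> A}"
    by (auto simp: insert_commute)
  then show ?thesis
    by (simp add: perfect_matchings_def Un_commute)
qed

lemma perfect_matchings_empty: "perfect_matchings {} {} = {{}}"
  by (auto simp: perfect_matchings_def)

lemma finite_perfect_matchings:
  assumes "finite A" "finite B"
  shows "finite (perfect_matchings A B)"
proof (rule finite_subset)
  show "perfect_matchings A B \<subseteq> Pow (Pow (A \<union> B))"
    by (auto simp: perfect_matchings_def)
qed (use assms in simp)

lemma perfect_matching_edgeE:
  assumes "M \<in> perfect_matchings A B" "e \<in> M"
  obtains u v where "u \<in> A" "v \<in> B" "e = {u, v}"
  using assms by (auto simp: perfect_matchings_def)

lemma perfect_matching_edge_unique: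
  assumes "M \<in> perfect_matchings A B" "x \<in> A \<union> B" "e \<in> M" "x \<in> e" "f \<in> M" "x \<in> f"
  shows "e = f"
  using assms by (auto simp: perfect_matchings_def)

lemma insert_edge_perfect_matching:
  assumes disj: "L \<inter> R = {}" and v: "v \<in> L" and u: "u \<in> R"
    and M: "M \<in> perfect_matchings (L - {v}) (R - {u})"
  shows "insert {v, u} M \<in> perfect_matchings L R"
  unfolding perfect_matchings_def
proof (intro CollectI conjI ballI)
  show "insert {v, u} M \<subseteq> {{u, v} | u v. u \<in> L \<and> v \<in> R}"
    using v u by (auto elim!: perfect_matching_edgeE[OF M])
  fix x assume x: "x \<in> L \<union> R"
  have avoid: "v \<notin> e" "u \<notin> e" if "e \<in> M" for e
    using that disj v u by (auto elim!: perfect_matching_edgeE[OF M])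
  show "\<exists>!e. e \<in> insert {v, u} M \<and> x \<in> e"
  proof (cases "x = v \<or> x = u")
    case True
    then show ?thesis using avoid by (intro ex1I[of _ "{v, u}"]) auto
  next
    case False
    then have "\<exists>!e. e \<in> M \<and> x \<in> e"
      using M x by (auto simp: perfect_matchings_def)
    then show ?thesis using False by auto
  qed
qed

lemma perfect_matching_remove_edge:
  assumes disj: "L \<inter> R = {}" and v: "v \<in> L"
    and M: "M \<in> perfect_matchings L R"
  obtains u where "u \<in> R" "{v, u} \<in> M" "M - {{v, u}} \<in> perfect_matchings (L - {v}) (R - {u})"
proof -
  obtain e where e: "e \<in> M" "v \<in> e"
    using M v unfolding perfect_matchings_def by blast
  then obtain u where u: "u \<in> R" "e = {v, u}"
    using disj v by (auto elim!: perfect_matching_edgeE[OF M])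
  have avoid: "v \<notin> f \<and> u \<notin> f" if "f \<in> M - {e}" for f
    using perfect_matching_edge_unique[OF M, of v f e] perfect_matching_edge_unique[OF M, of u f e]
      that e u v by auto
  have "M - {e} \<in> perfect_matchings (L - {v}) (R - {u})"
    unfolding perfect_matchings_def
  proof (intro CollectI conjI ballI)
    show "M - {e} \<subseteq> {{u', v'} | u' v'. u' \<in> L - {v} \<and> v' \<in> R - {u}}"
    proof
      fix f assume f: "f \<in> M - {e}"
      then obtain x y where "x \<in> L" "y \<in> R" "f = {x, y}"
        using perfect_matching_edgeE[OF M, of f] by blast
      then show "f \<in> {{u', v'} | u' v'. u' \<in> L - {v} \<and> v' \<in> R - {u}}"
        using avoid[OF f] by auto
    qed
    fix x assume x: "x \<in> L - {v} \<union> (R - {u})"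
    then have "x \<notin> e" "x \<in> L \<union> R" using u disj v by auto
    then show "\<exists>!f. f \<in> M - {e} \<and> x \<in> f"
      using M unfolding perfect_matchings_def by blast
  qed
  then show thesis using that u e by auto
qed

text \<open>Deleting the edge at \<open>v\<close> and inserting it back are inverse operations, so
  the matchings split according to the partner of \<open>v\<close>. This is what allows a uniform
  matching to be revealed one vertex at a time.\<close>

lemma sum_perfect_matchings:
  fixes f :: "'a set set \<Rightarrow> 'b::comm_monoid_add"
  assumes fin: "finite L" "finite R" and disj: "L \<inter> R = {}" and v: "v \<in> L"
  shows "sum f (perfect_matchings L R) =
    (\<Sum>u\<in>R. \<Sum>M\<in>perfect_matchings (L - {v}) (R - {u}). f (insert {v, u} M))"
proof -
  let ?S = "SIGMA u:R. perfect_matchings (L - {v}) (R - {u})"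
  \<comment> \<open>The smaller matching does not cover \<open>v\<close>, so the inserted edge, and
    with it \<open>u\<close>, can be read off from the image.\<close>
  have notin: "{v, w} \<notin> M" if "M \<in> perfect_matchings (L - {v}) (R - {u})" for M u w
    using that disj v by (auto simp: doubleton_eq_iff elim!: perfect_matching_edgeE[OF that])
  have "bij_betw (\<lambda>(u, M). insert {v, u} M) ?S (perfect_matchings L R)"
  proof (rule bij_betw_imageI)
    show "inj_on (\<lambda>(u, M). insert {v, u} M) ?S"
    proof (rule inj_onI, clarify)
      fix u M u' M'
      assume a: "u \<in> R" "M \<in> perfect_matchings (L - {v}) (R - {u})"
        "u' \<in> R" "M' \<in> perfect_matchings (L - {v}) (R - {u'})"
        "insert {v, u} M = insert {v, u'} M'"
      have "{v, u} = {v, u'}" using notin[OF a(4)] a(5) by blast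
      then have "u = u'" by (metis doubleton_eq_iff)
      then show "u = u' \<and> M = M'"
        using notin[OF a(2)] notin[OF a(4)] a(5) by (metis insert_ident)
    qed
    show "(\<lambda>(u, M). insert {v, u} M) ` ?S = perfect_matchings L R"
    proof (intro equalityI subsetI)
      fix M assume "M \<in> (\<lambda>(u, M). insert {v, u} M) ` ?S"
      then show "M \<in> perfect_matchings L R"
        using insert_edge_perfect_matching[OF disj v] by auto
    next
      fix M assume M: "M \<in> perfect_matchings L R"
      obtain u where u: "u \<in> R" "{v, u} \<in> M"
        "M - {{v, u}} \<in> perfect_matchings (L - {v}) (R - {u})"
        using perfect_matching_remove_edge[OF disj v M] by blast
      then show "M \<in> (\<lambda>(u, M). insert {v, u} M) ` ?S"
        by (intro image_eqI[of _ _ "(u, M - {{v, u}})"]) auto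
    qed
  qed
  then have "sum f (perfect_matchings L R) = (\<Sum>(u, M)\<in>?S. f (insert {v, u} M))"
    by (simp add: case_prod_unfold sum.reindex_bij_betw[symmetric])
  also have "\<dots> = (\<Sum>u\<in>R. \<Sum>M\<in>perfect_matchings (L - {v}) (R - {u}). f (insert {v, u} M))"
    using fin by (subst sum.Sigma) (auto intro: finite_perfect_matchings)
  finally show ?thesis .
qed

lemma card_perfect_matchings:
  assumes "finite L" "finite R" "L \<inter> R = {}" "card L = card R"
  shows "card (perfect_matchings L R) = fact (card R)"
  using assms
proof (induction "card R" arbitrary: L R)
  case 0
  then show ?case by (simp add: perfect_matchings_empty)
next
  case (Suc k)
  then obtain v where v: "v \<in> L" by (metis card.empty equals0I nat.distinct(1))
  have "card (perfect_matchings (L - {v}) (R - {u})) = fact k" if "u \<in> R" for u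
    using Suc.hyps(1)[of "R - {u}" "L - {v}"] Suc.prems Suc.hyps(2)[symmetric] v that by auto
  then have "card (perfect_matchings L R) = (\<Sum>u\<in>R. fact k)"
    using sum_perfect_matchings[OF Suc.prems(1-3) v, of "\<lambda>_. 1::nat"] by simp
  then show ?case using Suc.hyps(2)[symmetric] by simp
qed

lemma perfect_matchings_nonempty:
  assumes "finite L" "finite R" "L \<inter> R = {}" "card L = card R"
  shows "perfect_matchings L R \<noteq> {}"
  using card_perfect_matchings[OF assms] by auto

text \<open>An exponential moment, kept as an unnormalised sum so that the induction needs no
  conditional probabilities. Revealing the partner of a vertex of \<open>A\<close> contributes
  \<open>z\<close> if the edge lies in \<open>C\<close> and 1 otherwise, on average at most
  \<open>z + (1 - z) * p\<close>. The number \<open>card R - card A + 1\<close> counts the partners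
  still free when the last vertex of \<open>A\<close> is revealed; it is the same for the smaller
  instance, which therefore inherits the hypothesis.\<close>

lemma sum_power_card_perfect_matchings:
  fixes p z :: real
  assumes "finite L" "finite R" "L \<inter> R = {}" "card L = card R"
    and z: "0 \<le> z" "z \<le> 1" and p: "0 \<le> p"
    and "A \<subseteq> L"
    and "\<And>v. v \<in> A \<Longrightarrow> real (card {u \<in> R. {v, u} \<notin> C}) \<le> p * (real (card R) - real (card A) + 1)"
  shows "(\<Sum>M\<in>perfect_matchings L R. z ^ card (M \<inter> C)) \<le> fact (card R) * (z + (1 - z) * p) ^ card A"
  using assms(1-4,8-)
proof (induction "card A" arbitrary: A L R)
  case 0
  have "(\<Sum>M\<in>perfect_matchings L R. z ^ card (M \<inter> C)) \<le> (\<Sum>M\<in>perfect_matchings L R. 1)"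
    using z by (intro sum_mono) (simp add: power_le_one)
  then show ?case using 0 by (simp add: card_perfect_matchings)
next
  case (Suc k)
  let ?q = "z + (1 - z) * p"
  obtain v where v: "v \<in> A" using Suc.hyps(2) by (metis card.empty equals0I nat.distinct(1))
  have vL: "v \<in> L" using v Suc.prems by auto
  have fA: "finite A" using Suc.prems by (metis finite_subset)
  have cA: "card (A - {v}) = k" using Suc.hyps(2)[symmetric] v fA by simp
  obtain b where b: "card R = Suc b" using vL Suc.prems by (metis card_Suc_Diff1)
  have le: "card A \<le> card R" using Suc.prems by (metis card_mono)
  have q0: "0 \<le> ?q" using z p by simp
  have inner: "(\<Sum>M\<in>perfect_matchings (L - {v}) (R - {u}). z ^ card (insert {v, u} M \<inter> C))
      \<le> (if {v, u} \<in> C then z else 1) * (fact b * ?q ^ k)" if u: "u \<in> R" for u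
  proof -
    have cR: "card (R - {u}) = b" using u b Suc.prems by simp
    have ih: "(\<Sum>M\<in>perfect_matchings (L - {v}) (R - {u}). z ^ card (M \<inter> C))
      \<le> fact b * ?q ^ k"
      unfolding cR[symmetric] cA[symmetric]
    proof (rule Suc.hyps(1))
      fix w assume w: "w \<in> A - {v}"
      have "card {x \<in> R - {u}. {w, x} \<notin> C} \<le> card {x \<in> R. {w, x} \<notin> C}"
        using Suc.prems by (intro card_mono) auto
      also have "real \<dots> \<le> p * (real (card R) - real (card A) + 1)"
        using w Suc.prems by auto
      also have "\<dots> = p * (real (card (R - {u})) - real (card (A - {v})) + 1)"
        using b cR cA Suc.hyps(2)[symmetric] by simp
      finally show "real (card {x \<in> R - {u}. {w, x} \<notin> C}) \<le>
        p * (real (card (R - {u})) - real (card (A - {v})) + 1)" by simp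
    qed (use Suc.prems cA vL u b cR in auto)
    have "z ^ card (insert {v, u} M \<inter> C) = (if {v, u} \<in> C then z else 1) * z ^ card (M \<inter> C)"
      if M: "M \<in> perfect_matchings (L - {v}) (R - {u})" for M
    proof -
      have "{v, u} \<notin> M"
        using Suc.prems(3) vL by (auto simp: doubleton_eq_iff elim!: perfect_matching_edgeE[OF M])
      moreover have "finite M"
      proof (rule finite_subset)
        show "M \<subseteq> Pow (L \<union> R)" by (auto elim!: perfect_matching_edgeE[OF M])
      qed (use Suc.prems in simp)
      ultimately show ?thesis by (simp add: Int_insert_left)
    qed
    then have "(\<Sum>M\<in>perfect_matchings (L - {v}) (R - {u}). z ^ card (insert {v, u} M \<inter> C))
      = (if {v, u} \<in> C then z else 1) * (\<Sum>M\<in>perfect_matchings (L - {v}) (R - {u}). z ^ card (M \<inter> C))"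
      by (simp add: sum_distrib_left cong: sum.cong)
    then show ?thesis using ih z by (auto intro: mult_left_mono)
  qed
  have "(\<Sum>u\<in>R. if {v, u} \<in> C then z else 1)
      = (\<Sum>u\<in>R. z + (1 - z) * of_bool ({v, u} \<notin> C))"
    by (intro sum.cong) auto
  also have "\<dots> = z * card R + (1 - z) * card {u \<in> R. {v, u} \<notin> C}"
    using Suc.prems(2)
    by (simp add: sum.distrib flip: sum_distrib_left) (simp add: Int_def)
  also have "\<dots> \<le> z * card R + (1 - z) * (p * card R)"
  proof -
    have "real (card {u \<in> R. {v, u} \<notin> C}) \<le> p * (real (card R) - real (card A) + 1)"
      using Suc.prems v by blast
    \<comment> \<open>\<open>A\<close> contains \<open>v\<close>, so
      \<open>card R - card A + 1\<close> is at most \<open>card R\<close>, the number of choices for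
      the partner of \<open>v\<close>.\<close>
    also have "\<dots> \<le> p * card R"
      using p Suc.hyps(2)[symmetric] by (intro mult_left_mono) auto
    finally show ?thesis using z by (simp add: mult_left_mono)
  qed
  also have "\<dots> = ?q * card R" by (simp add: algebra_simps)
  finally have outer: "(\<Sum>u\<in>R. if {v, u} \<in> C then z else 1) \<le> ?q * card R" .
  have "(\<Sum>M\<in>perfect_matchings L R. z ^ card (M \<inter> C))
      \<le> (\<Sum>u\<in>R. (if {v, u} \<in> C then z else 1) * (fact b * ?q ^ k))"
    unfolding sum_perfect_matchings[OF Suc.prems(1-3) vL] by (intro sum_mono inner)
  also have "\<dots> \<le> ?q * card R * (fact b * ?q ^ k)"
    unfolding sum_distrib_right[symmetric] using q0 by (intro mult_right_mono outer) simp
  also have "\<dots> = fact (card R) * ?q ^ card A"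
    using b Suc.hyps(2)[symmetric] by (simp add: algebra_simps)
  finally show ?case .
qed

section \<open>Boundaries in unions of random matchings\<close>

lemma nn_integral_power_card_perfect_matchings:
  fixes p z :: real
  assumes fin: "finite L" "finite R" "L \<inter> R = {}" "card L = card R"
    and z: "0 \<le> z" "z \<le> 1" and p: "0 \<le> p"
    and A: "A \<subseteq> L"
    and C: "\<And>v. v \<in> A \<Longrightarrow> real (card {u \<in> R. {v, u} \<notin> C}) \<le> p * (real (card R) - real (card A) + 1)"
  shows "(\<integral>\<^sup>+M. ennreal (z ^ card (M \<inter> C)) \<partial>pmf_of_set (perfect_matchings L R))
    \<le> ennreal ((z + (1 - z) * p) ^ card A)"
proof -
  let ?PM = "perfect_matchings L R"
  have "(\<integral>\<^sup>+M. ennreal (z ^ card (M \<inter> C)) \<partial>pmf_of_set ?PM)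
      = ennreal ((\<Sum>M\<in>?PM. z ^ card (M \<inter> C)) / card ?PM)"
    using z fin
    by (simp add: nn_integral_pmf_of_set finite_perfect_matchings perfect_matchings_nonempty
        sum_ennreal ennreal_of_nat_eq_real_of_nat divide_ennreal sum_nonneg
        card_perfect_matchings)
  also have "\<dots> \<le> ennreal ((z + (1 - z) * p) ^ card A)"
    using sum_power_card_perfect_matchings[OF fin z p A C] fin
    by (intro ennreal_leI) (simp add: card_perfect_matchings divide_le_eq mult.commute)
  finally show ?thesis .
qed

lemma card_neighbours_Union_matchings:
  assumes "L \<inter> R = {}" "v \<in> L" "\<And>k. k < n \<Longrightarrow> M k \<in> perfect_matchings L R"
  shows "finite {u. {v, u} \<in> (\<Union>k<n. M k)} \<and> card {u. {v, u} \<in> (\<Union>k<n. M k)} \<le> n"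
proof -
  have single: "finite {u. {v, u} \<in> M k} \<and> card {u. {v, u} \<in> M k} \<le> 1" if "k < n" for k
  proof -
    have "x = y" if "{v, x} \<in> M k" "{v, y} \<in> M k" for x y
      using perfect_matching_edge_unique[OF assms(3)[OF \<open>k < n\<close>], of v "{v, x}" "{v, y}"]
        that assms(2) by (auto simp: doubleton_eq_iff)
    then have "{u. {v, u} \<in> M k} \<subseteq> {SOME u. {v, u} \<in> M k}"
      by (auto intro: someI2)
    then show ?thesis by (metis card.empty card.insert card_mono empty_iff finite.emptyI finite.insertI
          finite_subset One_nat_def)
  qed
  have eq: "{u. {v, u} \<in> (\<Union>k<n. M k)} = (\<Union>k<n. {u. {v, u} \<in> M k})" by auto
  have "card (\<Union>k<n. {u. {v, u} \<in> M k}) \<le> (\<Sum>k<n. card {u. {v, u} \<in> M k})"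
    by (rule card_UN_le) simp
  also have "\<dots> \<le> (\<Sum>k<n. 1)" using single by (intro sum_mono) auto
  finally show ?thesis unfolding eq using single by simp
qed

text \<open>Induction over the matchings, conditioning on the earlier ones. Only edges of
  \<open>D\<close> that are not yet present count, so the new matching is tested against
  \<open>D\<close> minus the union so far. From a vertex of \<open>A'\<close> such an edge is missed
  only if its end lies in \<open>B\<close> or among the earlier neighbours, at most one per
  matching. In \<open>deg\<close> the total number \<open>n\<close> stands for the latter, so that a
  single \<open>p\<close> serves all matchings.\<close>

lemma nn_integral_power_card_cut_Union_matchings:
  fixes p z :: real
  assumes fin: "finite L" "finite R" and disj: "L \<inter> R = {}" and card: "card L = card R"
    and z: "0 \<le> z" "z \<le> 1" and p: "0 \<le> p"
    and A: "A \<subseteq> L" and B: "B \<subseteq> R" and A': "A' \<subseteq> A"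
    and deg: "real (card B) + real n \<le> p * (real (card R) - real (card A') + 1)"
    and D: "D = {{v, u} | v u. v \<in> A \<and> u \<in> R - B}"
  shows "(\<integral>\<^sup>+M. ennreal (z ^ card (D \<inter> (\<Union>k<n. M k)))
      \<partial>Pi_pmf {..<n} {} (\<lambda>_. pmf_of_set (perfect_matchings L R)))
    \<le> ennreal (((z + (1 - z) * p) ^ card A') ^ n)"
  using deg
proof (induction n)
  case 0
  then show ?case by simp
next
  case (Suc n)
  let ?U = "pmf_of_set (perfect_matchings L R)" and ?q = "(z + (1 - z) * p) ^ card A'"
  have finD: "finite D"
  proof (rule finite_subset)
    show "D \<subseteq> Pow (L \<union> R)" using A D by auto
  qed (use fin in simp)
  have q0: "0 \<le> ?q" using z p by simp
  have split: "Pi_pmf {..<Suc n} {} (\<lambda>_. ?U)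
    = do {f \<leftarrow> Pi_pmf {..<n} {} (\<lambda>_. ?U); y \<leftarrow> ?U; return_pmf (f(n := y))}"
    unfolding lessThan_Suc by (subst Pi_pmf_insert') (auto intro: bind_commute_pmf)
  have inner: "(\<integral>\<^sup>+y. ennreal (z ^ card (D \<inter> (\<Union>k<Suc n. (f(n := y)) k))) \<partial>?U)
      \<le> ennreal (z ^ card (D \<inter> (\<Union>k<n. f k))) * ennreal ?q"
    if f: "\<And>k. k < n \<Longrightarrow> f k \<in> perfect_matchings L R" for f
  proof -
    let ?G = "\<Union>k<n. f k"
    have "card (D \<inter> (\<Union>k<Suc n. (f(n := y)) k)) = card (D \<inter> ?G) + card (y \<inter> (D - ?G))" for y
    proof -
      have "D \<inter> (\<Union>k<Suc n. (f(n := y)) k) = (D \<inter> ?G) \<union> (y \<inter> (D - ?G))"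
        by (auto simp: less_Suc_eq split: if_splits)
      then show ?thesis using finD by (simp add: card_Un_disjoint Int_Diff disjoint_iff)
    qed
    then have "(\<integral>\<^sup>+y. ennreal (z ^ card (D \<inter> (\<Union>k<Suc n. (f(n := y)) k))) \<partial>?U)
      = ennreal (z ^ card (D \<inter> ?G)) * (\<integral>\<^sup>+y. ennreal (z ^ card (y \<inter> (D - ?G))) \<partial>?U)"
      using z by (simp add: power_add ennreal_mult nn_integral_cmult)
    also have "(\<integral>\<^sup>+y. ennreal (z ^ card (y \<inter> (D - ?G))) \<partial>?U) \<le> ennreal ?q"
    proof (rule nn_integral_power_card_perfect_matchings[OF fin disj card z p])
      fix v assume v: "v \<in> A'"
      have nb: "finite {u. {v, u} \<in> ?G}" "card {u. {v, u} \<in> ?G} \<le> n"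
        using card_neighbours_Union_matchings[of L R v n f] disj f v A A' by blast+
      have "{u \<in> R. {v, u} \<notin> D - ?G} \<subseteq> B \<union> {u. {v, u} \<in> ?G}"
        using v A' unfolding D by blast
      then have "card {u \<in> R. {v, u} \<notin> D - ?G} \<le> card (B \<union> {u. {v, u} \<in> ?G})"
        using nb finite_subset[OF B fin(2)] by (intro card_mono) auto
      also have "\<dots> \<le> card B + n"
        using nb card_Un_le[of B "{u. {v, u} \<in> ?G}"] by simp
      finally have "real (card {u \<in> R. {v, u} \<notin> D - ?G}) \<le> real (card B) + real (Suc n)"
        by linarith
      then show "real (card {u \<in> R. {v, u} \<notin> D - ?G}) \<le> p * (real (card R) - real (card A') + 1)"
        using Suc.prems by linarith
    qed (use A A' in auto)
    finally show ?thesis by (simp add: mult_left_mono)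
  qed
  have "(\<integral>\<^sup>+M. ennreal (z ^ card (D \<inter> (\<Union>k<Suc n. M k))) \<partial>Pi_pmf {..<Suc n} {} (\<lambda>_. ?U))
    = (\<integral>\<^sup>+f. \<integral>\<^sup>+y. ennreal (z ^ card (D \<inter> (\<Union>k<Suc n. (f(n := y)) k))) \<partial>?U
         \<partial>Pi_pmf {..<n} {} (\<lambda>_. ?U))"
    unfolding split by simp
  also have "\<dots> \<le> (\<integral>\<^sup>+f. ennreal (z ^ card (D \<inter> (\<Union>k<n. f k))) * ennreal ?q
         \<partial>Pi_pmf {..<n} {} (\<lambda>_. ?U))"
  proof (rule nn_integral_mono_AE, unfold AE_measure_pmf_iff, intro ballI inner)
    fix f k assume "f \<in> set_pmf (Pi_pmf {..<n} {} (\<lambda>_. ?U))" "k < n"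
    then show "f k \<in> perfect_matchings L R"
      using fin disj card
      by (auto simp: set_Pi_pmf PiE_dflt_def finite_perfect_matchings perfect_matchings_nonempty)
  qed
  also have "\<dots> \<le> ennreal (?q ^ n) * ennreal ?q"
    using Suc.IH Suc.prems by (simp add: nn_integral_multc mult_right_mono)
  also have "\<dots> = ennreal (?q ^ Suc n)"
    using q0 by (simp add: ennreal_mult[symmetric] mult.commute)
  finally show ?case .
qed

text \<open>Markov's inequality for \<open>z ^ X\<close> with \<open>X\<close> the number of edges
  in the cut: as \<open>z\<close> is at most 1, \<open>X < t\<close> forces
  \<open>z powr (- t) * z ^ X\<close> to be at least 1.\<close>

lemma prob_small_cut_Union_matchings:
  fixes p z :: real
  assumes fin: "finite L" "finite R" and disj: "L \<inter> R = {}" and card: "card L = card R"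
    and z: "0 < z" "z \<le> 1" and p: "0 \<le> p"
    and A: "A \<subseteq> L" and B: "B \<subseteq> R" and A': "A' \<subseteq> A"
    and deg: "real (card B) + real n \<le> p * (real (card R) - real (card A') + 1)"
    and D: "D = {{v, u} | v u. v \<in> A \<and> u \<in> R - B}"
  shows "measure_pmf.prob (Pi_pmf {..<n} {} (\<lambda>_. pmf_of_set (perfect_matchings L R)))
      {M. real (card (D \<inter> (\<Union>k<n. M k))) < t}
    \<le> z powr (- t) * (z + (1 - z) * p) ^ (card A' * n)"
proof -
  let ?Q = "Pi_pmf {..<n} {} (\<lambda>_. pmf_of_set (perfect_matchings L R))"
  let ?S = "{M. real (card (D \<inter> (\<Union>k<n. M k))) < t}"
  have "emeasure ?Q ?S = (\<integral>\<^sup>+M. indicator ?S M \<partial>?Q)" by simp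
  also have "\<dots> \<le> (\<integral>\<^sup>+M. ennreal (z powr (- t)) * ennreal (z ^ card (D \<inter> (\<Union>k<n. M k))) \<partial>?Q)"
  proof (rule nn_integral_mono)
    fix M
    have "1 \<le> z powr (- t) * z ^ card (D \<inter> (\<Union>k<n. M k))" if "M \<in> ?S"
    proof -
      have "z powr t \<le> z powr real (card (D \<inter> (\<Union>k<n. M k)))"
        using that z by (intro powr_mono') auto
      then show ?thesis using z by (simp add: powr_minus powr_realpow field_simps)
    qed
    then show "(indicator ?S M :: ennreal)
      \<le> ennreal (z powr (- t)) * ennreal (z ^ card (D \<inter> (\<Union>k<n. M k)))"
      using z by (auto simp: indicator_def ennreal_mult[symmetric] simp flip: ennreal_1 intro!: ennreal_leI)
  qed
  also have "\<dots> \<le> ennreal (z powr (- t)) * ennreal (((z + (1 - z) * p) ^ card A') ^ n)"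
    using nn_integral_power_card_cut_Union_matchings[OF fin disj card _ z(2) p A B A' deg D] z
    by (simp add: nn_integral_cmult mult_left_mono)
  also have "\<dots> = ennreal (z powr (- t) * (z + (1 - z) * p) ^ (card A' * n))"
    using z p by (simp add: ennreal_mult power_mult)
  finally show ?thesis
    using z p by (simp add: measure_pmf.emeasure_eq_measure)
qed

section \<open>Entropy and tail estimates for the union bound\<close>

text \<open>Compare one term of the binomial expansion of \<open>(1 + a / b) ^ b\<close> with the
  upper bound \<open>exp a\<close>. As \<open>a / b\<close> is at most 1, its power \<open>c\<close>
  may be replaced by the smaller power \<open>a\<close>, so one bound in terms of \<open>a\<close>
  covers every \<open>c\<close> up to \<open>a\<close>.\<close>

lemma binomial_le_exp_power:
  assumes "c \<le> a" "1 \<le> a" "a \<le> b"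
  shows "real (b choose c) \<le> (exp 1 * real b / real a) ^ a"
proof -
  let ?x = "real a / real b"
  have x: "0 < ?x" "?x \<le> 1" using assms by auto
  have "real (b choose c) * ?x ^ a \<le> real (b choose c) * ?x ^ c"
    using x assms by (intro mult_left_mono power_decreasing) auto
  also have "\<dots> \<le> (\<Sum>k\<le>b. real (b choose k) * ?x ^ k)"
    using x assms by (intro member_le_sum) auto
  also have "\<dots> = (?x + 1) ^ b" by (simp add: binomial_ring)
  also have "\<dots> \<le> exp ?x ^ b"
    using x exp_ge_add_one_self[of ?x] by (intro power_mono) (auto simp: add.commute)
  also have "\<dots> = exp 1 ^ a" using assms by (simp flip: exp_of_nat_mult)
  finally have "real (b choose c) \<le> exp 1 ^ a / ?x ^ a"
    using x by (subst pos_le_divide_eq) auto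
  also have "\<dots> = (exp 1 * real b / real a) ^ a" by (simp add: power_divide power_mult_distrib)
  finally show ?thesis .
qed

lemma binomial_product_le_powr:
  assumes "c \<le> a" "1 \<le> a" "a \<le> b"
  shows "real (b choose a) * real (b choose c) \<le> (exp 1 * real b / real a) powr (2 * real a)"
proof -
  let ?e = "exp 1 * real b / real a"
  have pos: "0 < ?e" using assms by auto
  have "real (b choose a) * real (b choose c) \<le> ?e ^ a * ?e ^ a"
    using assms pos by (intro mult_mono binomial_le_exp_power) auto
  also have "\<dots> = ?e powr (2 * real a)"
    using pos by (simp add: powr_realpow[symmetric] powr_add[symmetric])
  finally show ?thesis .
qed

text \<open>This is the Markov bound with \<open>z = p = P\<close>. The base is at most
  \<open>2 * P\<close>, hence at most \<open>P powr (2 / 3)\<close>, because the cube root of 1/8 is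
  1/2. With \<open>m\<close> at least \<open>x / 2\<close> the moment is at most
  \<open>P powr (n * x / 3)\<close>, and 1/3 - 1/25 = 22/75 exceeds 1/4.\<close>

lemma tail_bound_small_density:
  fixes P x :: real
  assumes "0 < P" "P \<le> 1 / 8" "0 \<le> x" "x \<le> 2 * real m"
  shows "P powr (- (real n * x / 25)) * (P + (1 - P) * P) ^ (m * n) \<le> P powr (real n * x / 4)"
proof -
  have "P powr (1 / 3) \<le> (1 / 8) powr (1 / 3)"
    using assms by (intro powr_mono2) auto
  also have "(1 / 8 :: real) powr (1 / 3) = ((1 / 2) powr 3) powr (1 / 3)"
    by (subst powr_numeral) (auto simp: power3_eq_cube)
  also have "\<dots> = 1 / 2" by (subst powr_powr) simp
  finally have "P powr (1 / 3) * P powr (2 / 3) \<le> (1 / 2) * P powr (2 / 3)"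
    by (intro mult_right_mono) auto
  then have "2 * P \<le> P powr (2 / 3)"
    using assms by (simp flip: powr_add)
  moreover have "P + (1 - P) * P \<le> 2 * P" using assms by (simp add: algebra_simps)
  ultimately have "(P + (1 - P) * P) ^ (m * n) \<le> (P powr (2 / 3)) ^ (m * n)"
    using assms by (intro power_mono) (linarith, simp)
  also have "\<dots> = P powr (2 / 3 * (real m * real n))"
    using assms by (simp add: powr_realpow[symmetric] powr_powr)
  also have "\<dots> \<le> P powr (real n * x / 3)"
    using assms mult_right_mono[OF assms(4), of "real n"]
    by (intro powr_mono') (auto simp: algebra_simps)
  finally have "P powr (- (real n * x / 25)) * (P + (1 - P) * P) ^ (m * n)
      \<le> P powr (- (real n * x / 25)) * P powr (real n * x / 3)"
    by (intro mult_left_mono) auto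
  also have "\<dots> = P powr (real n * x * (22 / 75))"
    by (simp flip: powr_add add: algebra_simps)
  also have "\<dots> \<le> P powr (real n * x / 4)"
    using assms by (intro powr_mono') auto
  finally show ?thesis .
qed

text \<open>Here \<open>a\<close> and \<open>c\<close> are the sizes of the two parts of a set and
  \<open>m\<close> is the number of revealed vertices; \<open>z\<close> and \<open>p\<close> are
  chosen so that the tail beats the number of such sets. The term \<open>b powr (- 3)\<close> comes
  from small \<open>a\<close>. Otherwise \<open>a\<close> exceeds
  \<open>b powr (1 - \<rho> / 2)\<close>, which is at least \<open>sqrt b\<close>, and a bound
  exponential in \<open>a\<close> gives \<open>2 powr (- sqrt b)\<close>.\<close>

lemma expansion_union_bound_term:
  fixes \<rho> :: real
  assumes \<rho>: "0 < \<rho>" "\<rho> < 1" and b: "3 \<le> b" and b_large: "real b powr (- \<rho> / 4) \<le> 1 / 6"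
    and a: "1 \<le> a" and c: "c \<le> a" "a + c \<le> b"
    and n: "1000 / \<rho> \<le> real n" "real n \<le> real b powr (1 - \<rho>)"
    and m: "m = a - a div 2"
  obtains z p :: real where "0 < z" "z \<le> 1" "0 \<le> p"
    "real c + real n \<le> p * (real b - real m + 1)"
    "real (b choose a) * real (b choose c) *
      (z powr (- (real n * real a / 25)) * (z + (1 - z) * p) ^ (m * n))
      \<le> real b powr (- 3) + 2 powr (- sqrt b)"
proof -
  \<comment> \<open>With this scale \<open>b * x ^ 4\<close> is the upper bound on \<open>n\<close>,
    and \<open>b * x ^ 2\<close>, halfway between it and \<open>b\<close> on the logarithmic scale,
    separates small sets from the others.\<close>
  define x where "x = real b powr (- \<rho> / 4)"
  define N where "N = real (b choose a) * real (b choose c)"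
  have N0: "0 \<le> N" by (simp add: N_def)
  have ab: "a \<le> b" using c by simp
  have N: "N \<le> (exp 1 * real b / real a) powr (2 * real a)"
    unfolding N_def using binomial_product_le_powr[OF c(1) a ab] .
  have x: "0 < x" "x \<le> 1 / 6" using b b_large by (auto simp: x_def)
  have x2: "real b * x\<^sup>2 = real b powr (1 - \<rho> / 2)"
    using b by (simp add: x_def powr_diff power2_eq_square powr_minus field_simps flip: powr_add)
  have x4: "real b * x ^ 4 = real b powr (1 - \<rho>)"
    using b by (simp add: x_def powr_diff power4_eq_xxxx powr_minus field_simps flip: powr_add)
  have xx: "x\<^sup>2 \<le> 1 / 36" "x ^ 4 \<le> x\<^sup>2" "x ^ 4 \<le> 1 / 1296"
    using x power_mono[of x "1/6" 2] power_mono[of x "1/6" 4]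
    by (auto simp: power_one_over intro: power_decreasing)
  have n2: "real n \<le> real b * x\<^sup>2"
    using n x4 xx b by (smt (verit) mult_left_mono of_nat_0_le_iff)
  have n16: "real n \<le> real b / 16"
    using n x4 mult_left_mono[OF xx(3), of "real b"] by auto
  have "1000 \<le> 1000 / \<rho>" using \<rho> by (simp add: field_simps)
  then have n1000: "1000 \<le> real n" using n by linarith
  have n\<rho>: "1000 \<le> \<rho> * real n" using n \<rho> by (simp add: field_simps)
  have m2: "real a \<le> 2 * real m" and mb: "real b - real a / 2 \<le> real b - real m + 1"
    using m by linarith+
  have e4: "exp 1 \<le> (4::real)" using exp_le by simp
  \<comment> \<open>In the first two regimes the failure probability per step is at most a small \<open>P\<close>, and \<open>z = P\<close>;
    the split at \<open>b powr (1 - \<rho> / 2)\<close> decides whether the entropy \<open>ln (b / a)\<close> is paid by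
    \<open>\<rho> * n \<ge> 1000\<close> or by the density \<open>a / b\<close> itself. In the third it is only known that \<open>P \<le> 3 / 4\<close>.\<close>
  consider (small) "real a \<le> real b * x\<^sup>2" | (mid) "real b * x\<^sup>2 < real a" "256 * real a \<le> real b"
    | (large) "real b < 256 * real a" "real b * x\<^sup>2 < real a"
    by linarith
  then show thesis
  proof cases
    case small
    \<comment> \<open>Both \<open>c\<close> and \<open>n\<close> are at most
      \<open>b * x ^ 2\<close>, and \<open>b - m + 1\<close> is at least \<open>b / 2\<close>; the
      quotient is at most \<open>P\<close>. Since \<open>P\<close> is at most \<open>x\<close>, the
      tail is at most \<open>b\<close> to the power \<open>- \<rho> * n * a / 16\<close>, hence at
      most \<open>b powr (- 60 * a)\<close>, against an entropy of
      \<open>b powr (4 * a)\<close>.\<close>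
    define P where "P = 4 * x\<^sup>2"
    have P: "0 < P" "P \<le> 1 / 8" using x xx by (auto simp: P_def)
    have "P = (4 * x) * x" by (simp add: P_def power2_eq_square)
    also have "\<dots> \<le> 1 * x" using x by (intro mult_right_mono) auto
    finally have Px: "P \<le> x" by simp
    have "P powr (real n * real a / 4) \<le> x powr (real n * real a / 4)"
      using P Px by (intro powr_mono2) auto
    also have "\<dots> = real b powr (- (\<rho> * real n) / 16 * real a)"
      by (simp add: x_def powr_powr algebra_simps)
    also have "\<dots> \<le> real b powr (- 60 * real a)"
      using b n\<rho> by (intro powr_mono mult_right_mono) auto
    finally have t: "P powr (real n * real a / 4) \<le> real b powr (- 60 * real a)" .
    have "exp 1 * real b / real a \<le> 3 * real b / 1"
      using a exp_le by (intro frac_le mult_right_mono) auto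
    also have "\<dots> \<le> real b powr 2" using b by (simp add: power2_eq_square)
    finally have "(exp 1 * real b / real a) powr (2 * real a) \<le> (real b powr 2) powr (2 * real a)"
      by (intro powr_mono2) auto
    then have N': "N \<le> real b powr (4 * real a)" using N unfolding powr_powr by simp
    have "N * (P powr (- (real n * real a / 25)) * (P + (1 - P) * P) ^ (m * n))
        \<le> N * P powr (real n * real a / 4)"
      using N0 tail_bound_small_density[OF P of_nat_0_le_iff m2] by (intro mult_left_mono)
    also have "\<dots> \<le> real b powr (4 * real a) * real b powr (- 60 * real a)"
      using N0 N' t by (intro mult_mono) auto
    also have "\<dots> = real b powr (- 56 * real a)" by (simp flip: powr_add)
    also have "\<dots> \<le> real b powr (- 3)" using a b by (intro powr_mono) auto
    finally have fin: "N * (P powr (- (real n * real a / 25)) * (P + (1 - P) * P) ^ (m * n))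
        \<le> real b powr (- 3) + 2 powr (- sqrt b)" by (simp add: add_increasing2)
    have "real c + real n \<le> 4 * x\<^sup>2 * (real b / 2)" using small n2 c by simp
    also have "\<dots> \<le> P * (real b - real m + 1)"
      unfolding P_def using mb ab by (intro mult_left_mono) auto
    finally show thesis using that[of P P] P fin by (simp add: N_def)
  next
    case mid
    \<comment> \<open>Now \<open>n\<close> is at most \<open>b * x ^ 2\<close>, hence below
      \<open>a\<close>, so \<open>c + n\<close> is at most \<open>2 * a\<close>; dividing by
      \<open>b / 2\<close> gives \<open>P\<close>. In terms of \<open>P\<close> the entropy factor
      \<open>exp 1 * b / a\<close> is at most \<open>16 / P\<close>, hence at most
      \<open>P powr (- 2)\<close>.\<close>
    define P where "P = 4 * real a / real b"
    have P: "0 < P" "P \<le> 1 / 64" using a ab mid by (auto simp: P_def field_simps)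
    have sq: "sqrt b \<le> real a"
    proof -
      have "sqrt b = real b powr (1 / 2)" by (simp add: powr_half_sqrt)
      also have "\<dots> \<le> real b * x\<^sup>2" unfolding x2 using b \<rho> by (intro powr_mono) auto
      finally show ?thesis using mid by simp
    qed
    have "exp 1 * real b / real a = 4 * exp 1 / P" using a b by (simp add: P_def)
    also have "\<dots> \<le> 16 / P" using P e4 by (intro divide_right_mono) auto
    also have "\<dots> \<le> P powr (- 2)"
      using P by (simp add: powr_minus field_simps power2_eq_square)
    finally have "(exp 1 * real b / real a) powr (2 * real a) \<le> (P powr (- 2)) powr (2 * real a)"
      by (intro powr_mono2) auto
    then have N': "N \<le> P powr (- 4 * real a)" using N unfolding powr_powr by simp
    have "P powr (real n * real a / 4) \<le> P powr (250 * real a)"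
      using P n1000 mult_right_mono[OF n1000, of "real a"] by (intro powr_mono') auto
    have "N * (P powr (- (real n * real a / 25)) * (P + (1 - P) * P) ^ (m * n))
        \<le> N * P powr (real n * real a / 4)"
      using N0 P tail_bound_small_density[OF P(1) _ of_nat_0_le_iff m2] by (intro mult_left_mono) auto
    also have "\<dots> \<le> P powr (- 4 * real a) * P powr (250 * real a)"
      using N0 N' \<open>P powr (real n * real a / 4) \<le> P powr (250 * real a)\<close> by (intro mult_mono) auto
    also have "\<dots> = P powr (246 * real a)" by (simp flip: powr_add)
    also have "\<dots> \<le> P powr (real a)" using P by (intro powr_mono') auto
    also have "\<dots> \<le> (1 / 2) powr (real a)" using P by (intro powr_mono2) auto
    also have "\<dots> \<le> (1 / 2) powr (sqrt b)" using sq by (intro powr_mono') auto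
    also have "\<dots> = 2 powr (- sqrt b)" by (simp add: powr_minus powr_divide field_simps)
    finally have fin: "N * (P powr (- (real n * real a / 25)) * (P + (1 - P) * P) ^ (m * n))
        \<le> real b powr (- 3) + 2 powr (- sqrt b)" by (simp add: add_increasing)
    have "real c + real n \<le> P * (real b / 2)" using mid n2 c b by (simp add: P_def)
    also have "\<dots> \<le> P * (real b - real m + 1)"
      using P mb ab by (intro mult_left_mono) auto
    finally show thesis using that[of P P] P fin by (simp add: N_def)
  next
    case large
    have sq: "sqrt b \<le> real a"
    proof -
      have "sqrt b = real b powr (1 / 2)" by (simp add: powr_half_sqrt)
      also have "\<dots> \<le> real b * x\<^sup>2" unfolding x2 using b \<rho> by (intro powr_mono) auto
      finally show ?thesis using large by simp
    qed
    have "exp 1 * real b / real a = exp 1 * (real b / real a)" by simp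
    also have "\<dots> \<le> 4 * 256" using large a e4 by (intro mult_mono) (auto simp: field_simps)
    also have "\<dots> = 2 powr 10" by simp
    finally have "(exp 1 * real b / real a) powr (2 * real a) \<le> (2 powr 10) powr (2 * real a)"
      by (intro powr_mono2) auto
    also have "\<dots> = 2 powr (20 * real a)" by (simp only: powr_powr) simp
    finally have N': "N \<le> 2 powr (20 * real a)" using N by simp
    \<comment> \<open>For \<open>z = 1 / 2\<close> and \<open>p = 3 / 4\<close> every revealed
      vertex contributes 7/8. As \<open>m\<close> is at least \<open>a / 2\<close>, the moment is at
      most 2 to the power \<open>- 2 * n * a / 25\<close>. Half of this exponent pays for the Markov
      factor; the other half is at least \<open>40 * a\<close>, twice the entropy
      \<open>20 * a\<close>.\<close>
    have "(7 / 8 :: real) = ((7 / 8) powr 25) powr (1 / 25)" by (simp only: powr_powr) simp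
    also have "\<dots> \<le> (2 powr (- 4)) powr (1 / 25)"
      by (intro powr_mono2) (auto simp: powr_minus power_divide)
    also have "\<dots> = 2 powr (- 4 / 25)" by (simp only: powr_powr) simp
    finally have "(7 / 8 :: real) ^ (m * n) \<le> (2 powr (- 4 / 25)) ^ (m * n)"
      by (intro power_mono) auto
    also have "\<dots> = 2 powr (- 4 / 25 * (real m * real n))"
      by (simp add: powr_realpow[symmetric] powr_powr)
    also have "\<dots> \<le> 2 powr (- 2 / 25 * (real n * real a))"
      using mult_right_mono[OF m2, of "real n"] by (intro powr_mono) (auto simp: algebra_simps)
    finally have "2 powr (real n * real a / 25) * (7 / 8) ^ (m * n)
        \<le> 2 powr (real n * real a / 25) * (2 powr (- 2 / 25 * (real n * real a)))"
      by (intro mult_left_mono) auto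
    also have "2 powr (real n * real a / 25) * 2 powr (- 2 / 25 * (real n * real a))
      = 2 powr (- (real n * real a / 25))"
      by (simp flip: powr_add add: mult.commute)
    also have "\<dots> \<le> 2 powr (- 40 * real a)"
      using mult_right_mono[OF n1000, of "real a"] by (intro powr_mono) auto
    finally have "2 powr (real n * real a / 25) * (7 / 8) ^ (m * n) \<le> 2 powr (- 40 * real a)" .
    moreover have "(1 / 2 :: real) powr (- (real n * real a / 25)) = 2 powr (real n * real a / 25)"
      by (simp add: powr_minus powr_divide field_simps)
    ultimately have t: "(1 / 2) powr (- (real n * real a / 25)) * (7 / 8) ^ (m * n)
        \<le> (2::real) powr (- 40 * real a)" by (simp only:)
    have "N * ((1 / 2) powr (- (real n * real a / 25)) * (7 / 8) ^ (m * n))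
        \<le> 2 powr (20 * real a) * 2 powr (- 40 * real a)"
      using N0 N' t by (intro mult_mono) auto
    also have "\<dots> = 2 powr (- 20 * real a)" by (simp flip: powr_add)
    also have "\<dots> \<le> 2 powr (- sqrt b)" using sq by (intro powr_mono) auto
    finally have fin: "N * ((1 / 2) powr (- (real n * real a / 25)) * (7 / 8) ^ (m * n))
        \<le> real b powr (- 3) + 2 powr (- sqrt b)" by (simp add: add_increasing)
    \<comment> \<open>The extreme case is \<open>a = c = b / 2\<close> with
      \<open>n = b / 16\<close>: then \<open>c + n\<close> and \<open>3 / 4 * (b - a / 2)\<close>
      both equal \<open>9 * b / 16\<close>.\<close>
    have "real c + real n \<le> 3 / 4 * (real b - real m + 1)"
      using mb n16 c by simp
    then show thesis using that[of "1 / 2" "3 / 4"] fin by (simp add: N_def)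
  qed
qed

section \<open>Edge expansion with high probability\<close>

text \<open>Union bound, first over the at most \<open>b * (b + 1)\<close> pairs of sizes in
  \<open>J\<close>, then over all pairs of sets of these sizes. Only edges leaving the larger part
  \<open>A\<close> are counted.\<close>

lemma prob_one_sided_expansion_fails:
  fixes \<rho> :: real
  assumes fin: "finite L" "finite R" and disj: "L \<inter> R = {}" and card: "card L = b" "card R = b"
    and \<rho>: "0 < \<rho>" "\<rho> < 1" and b: "3 \<le> b" and b_large: "real b powr (- \<rho> / 4) \<le> 1 / 6"
    and n: "1000 / \<rho> \<le> real n" "real n \<le> real b powr (1 - \<rho>)"
  shows "measure_pmf.prob (Pi_pmf {..<n} {} (\<lambda>_. pmf_of_set (perfect_matchings L R)))
      {M. \<exists>A B. A \<subseteq> L \<and> B \<subseteq> R \<and> A \<noteq> {} \<and> card B \<le> card A \<and> card A + card B \<le> b \<and>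
         real (card ({{v, u} | v u. v \<in> A \<and> u \<in> R - B} \<inter> (\<Union>k<n. M k))) < real n * real (card A) / 25}
    \<le> real b * real (b + 1) * (real b powr (- 3) + 2 powr (- sqrt b))"
    (is "measure_pmf.prob ?Q ?bad \<le> _ * ?\<eta>")
proof -
  define F where "F = (\<lambda>A B. {M. real (card ({{v, u} | v u. v \<in> A \<and> u \<in> R - B} \<inter> (\<Union>k<n. M k)))
    < real n * real (card A) / 25})"
  define sub where "sub = (\<lambda>(X::'a set) k. {A. A \<subseteq> X \<and> card A = k})"
  define J where "J = {(a, c). 1 \<le> a \<and> c \<le> a \<and> a + c \<le> b}"
  have J: "J \<subseteq> {1..b} \<times> {0..b}" by (auto simp: J_def)
  then have finJ: "finite J" using finite_subset by blast
  have fin_sub: "finite (sub X k)" if "finite X" for X k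
    using that by (simp add: sub_def)
  have card_sub: "card (sub X k) = card X choose k" if "finite X" for X k
    using that by (simp add: sub_def n_subsets)
  have size: "measure_pmf.prob ?Q (\<Union>(A, B)\<in>sub L a \<times> sub R c. F A B) \<le> ?\<eta>"
    if "(a, c) \<in> J" for a c
  proof -
    \<comment> \<open>Half of \<open>A\<close>, rounded up, will be revealed: at least
      \<open>b / 2\<close> partners then stay available even if \<open>A\<close> is all of
      \<open>L\<close>.\<close>
    define m where "m = a - a div 2"
    have ac: "1 \<le> a" "c \<le> a" "a + c \<le> b" using that by (auto simp: J_def)
    obtain z p :: real where zp: "0 < z" "z \<le> 1" "0 \<le> p"
      "real c + real n \<le> p * (real b - real m + 1)"
      and bound: "real (b choose a) * real (b choose c) *
      (z powr (- (real n * real a / 25)) * (z + (1 - z) * p) ^ (m * n)) \<le> ?\<eta>"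
      using expansion_union_bound_term[OF \<rho> b b_large ac n m_def] by blast
    let ?t = "z powr (- (real n * real a / 25)) * (z + (1 - z) * p) ^ (m * n)"
    have each: "measure_pmf.prob ?Q (F A B) \<le> ?t" if "A \<in> sub L a" "B \<in> sub R c" for A B
    proof -
      have AB: "A \<subseteq> L" "B \<subseteq> R" "card A = a" "card B = c" using that by (auto simp: sub_def)
      obtain A' where A': "A' \<subseteq> A" "card A' = m"
        using obtain_subset_with_card_n[of m A] AB unfolding m_def by (metis diff_le_self)
      have "card L = card R" using card by simp
      from prob_small_cut_Union_matchings[OF fin disj this zp(1-3) AB(1,2) A'(1) _ refl,
          of n "real n * real a / 25"] zp(4)
      show ?thesis by (simp add: F_def AB A' card)
    qed
    have "measure_pmf.prob ?Q (\<Union>(A, B)\<in>sub L a \<times> sub R c. F A B)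
      \<le> (\<Sum>(A, B)\<in>sub L a \<times> sub R c. measure_pmf.prob ?Q (F A B))"
      using measure_pmf.finite_measure_subadditive_finite[of "sub L a \<times> sub R c" "\<lambda>(A, B). F A B" ?Q]
        fin by (simp add: fin_sub case_prod_unfold)
    also have "\<dots> \<le> (\<Sum>(A, B)\<in>sub L a \<times> sub R c. ?t)"
      using each by (intro sum_mono) auto
    also have "\<dots> = real (b choose a) * real (b choose c) * ?t"
      using fin card by (simp add: card_cartesian_product card_sub case_prod_unfold)
    finally show ?thesis using bound by simp
  qed
  have "?bad \<subseteq> (\<Union>(a, c)\<in>J. \<Union>(A, B)\<in>sub L a \<times> sub R c. F A B)"
  proof
    fix M assume "M \<in> ?bad"
    then obtain A B where AB: "A \<subseteq> L" "B \<subseteq> R" "A \<noteq> {}" "card B \<le> card A" "card A + card B \<le> b"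
      and M: "M \<in> F A B" by (auto simp: F_def)
    have "card A > 0" using AB fin by (meson card_gt_0_iff finite_subset)
    then have "(card A, card B) \<in> J" using AB by (auto simp: J_def)
    moreover have "(A, B) \<in> sub L (card A) \<times> sub R (card B)" using AB by (auto simp: sub_def)
    ultimately show "M \<in> (\<Union>(a, c)\<in>J. \<Union>(A, B)\<in>sub L a \<times> sub R c. F A B)"
      using M by blast
  qed
  then have "measure_pmf.prob ?Q ?bad
    \<le> measure_pmf.prob ?Q (\<Union>(a, c)\<in>J. \<Union>(A, B)\<in>sub L a \<times> sub R c. F A B)"
    by (intro measure_pmf.finite_measure_mono) auto
  also have "\<dots> \<le> (\<Sum>(a, c)\<in>J. measure_pmf.prob ?Q (\<Union>(A, B)\<in>sub L a \<times> sub R c. F A B))"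
    using measure_pmf.finite_measure_subadditive_finite[OF finJ,
        of "\<lambda>(a, c). \<Union>(A, B)\<in>sub L a \<times> sub R c. F A B" ?Q]
    by (simp add: case_prod_unfold)
  also have "\<dots> \<le> (\<Sum>(a, c)\<in>J. ?\<eta>)"
    using size by (intro sum_mono) auto
  also have "\<dots> = real (card J) * ?\<eta>" by (simp add: case_prod_unfold)
  also have "\<dots> \<le> real b * real (b + 1) * ?\<eta>"
  proof (intro mult_right_mono)
    have "card J \<le> b * (b + 1)"
      using card_mono[OF _ J] by (simp add: card_cartesian_product)
    then have "real (card J) \<le> real (b * (b + 1))" by (rule of_nat_mono)
    then show "real (card J) \<le> real b * real (b + 1)" by (simp only: of_nat_mult)
  qed simp
  finally show ?thesis .
qed

text \<open>An edge-isoperimetric inequality; the edge set on the right is the edge boundary of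
  \<open>S\<close>. As \<open>G\<close> is a set, merged parallel edges count once.\<close>

definition edge_expanding :: "'a set \<Rightarrow> 'a set set \<Rightarrow> real \<Rightarrow> bool" where
  "edge_expanding W G \<gamma> \<longleftrightarrow>
     (\<forall>S\<subseteq>W. 2 * card S \<le> card W \<longrightarrow> \<gamma> * real (card S) \<le> real (card {e \<in> G. e \<inter> S \<noteq> {} \<and> \<not> e \<subseteq> S}))"

text \<open>The side holding the larger part of \<open>S\<close> takes the role of \<open>L\<close>.
  That part has at least half of the vertices of \<open>S\<close>, so \<open>n / 25\<close> boundary
  edges per vertex of it become \<open>n / 50\<close> per vertex of \<open>S\<close>.\<close>

lemma prob_edge_expanding:
  fixes \<rho> :: real
  assumes fin: "finite L" "finite R" and disj: "L \<inter> R = {}" and card: "card L = b" "card R = b"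
    and \<rho>: "0 < \<rho>" "\<rho> < 1" and b: "3 \<le> b" and b_large: "real b powr (- \<rho> / 4) \<le> 1 / 6"
    and n: "1000 / \<rho> \<le> real n" "real n \<le> real b powr (1 - \<rho>)"
  shows "measure_pmf.prob (Pi_pmf {..<n} {} (\<lambda>_. pmf_of_set (perfect_matchings L R)))
      {M. edge_expanding (L \<union> R) (\<Union>k<n. M k) (real n / 50)}
    \<ge> 1 - 2 * (real b * real (b + 1) * (real b powr (- 3) + 2 powr (- sqrt b)))"
proof -
  let ?Q = "Pi_pmf {..<n} {} (\<lambda>_. pmf_of_set (perfect_matchings L R))"
  let ?bad = "\<lambda>L R. {M. \<exists>A B. A \<subseteq> L \<and> B \<subseteq> R \<and> A \<noteq> {} \<and> card B \<le> card A \<and> card A + card B \<le> b \<and>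
         real (card ({{v, u} | v u. v \<in> A \<and> u \<in> R - B} \<inter> (\<Union>k<n. M k))) < real n * real (card A) / 25}"
  let ?good = "{M. edge_expanding (L \<union> R) (\<Union>k<n. M k) (real n / 50)}"
  let ?\<eta> = "real b * real (b + 1) * (real b powr (- 3) + 2 powr (- sqrt b))"
  have one_side: "real n / 50 * real (card S) \<le> real (card {e \<in> G. e \<inter> S \<noteq> {} \<and> \<not> e \<subseteq> S})"
    if M: "M \<notin> ?bad X Y" and XY: "X \<union> Y = L \<union> R" "X \<inter> Y = {}" and S: "S \<subseteq> L \<union> R" "2 * card S \<le> card (L \<union> R)"
      and le: "card (S \<inter> Y) \<le> card (S \<inter> X)" and G: "G = (\<Union>k<n. M k)" and finG: "finite G"
    for M S X Y G
  proof (cases "S \<inter> X = {}")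
    case True
    then have "card (S \<inter> Y) = 0" using le by simp
    moreover have "finite S" using S fin finite_subset by blast
    ultimately have "S = {}" using True S XY by auto
    then show ?thesis by simp
  next
    case False
    let ?D = "{{v, u} | v u. v \<in> S \<inter> X \<and> u \<in> Y - S \<inter> Y}"
    have finS: "finite S" using S fin finite_subset by blast
    have "S = (S \<inter> X) \<union> (S \<inter> Y)" using S XY by auto
    moreover have "card ((S \<inter> X) \<union> (S \<inter> Y)) = card (S \<inter> X) + card (S \<inter> Y)"
      using finS XY by (intro card_Un_disjoint) auto
    ultimately have cS: "card S = card (S \<inter> X) + card (S \<inter> Y)" by simp
    have "card (L \<union> R) = 2 * b" using fin disj card by (simp add: card_Un_disjoint)
    then have "card (S \<inter> X) + card (S \<inter> Y) \<le> b" using S cS by simp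
    then have "\<not> real (card (?D \<inter> G)) < real n * real (card (S \<inter> X)) / 25"
      using M[unfolded mem_Collect_eq not_ex, THEN spec, of "S \<inter> X", THEN spec, of "S \<inter> Y"] False le
      unfolding G by (simp only: Int_lower2 simp_thms)
    then have "real n * real (card (S \<inter> X)) / 25 \<le> real (card (?D \<inter> G))" by simp
    moreover have "card (?D \<inter> G) \<le> card {e \<in> G. e \<inter> S \<noteq> {} \<and> \<not> e \<subseteq> S}"
      using finG by (intro card_mono) auto
    moreover have "real n * real (card S) \<le> real n * (2 * real (card (S \<inter> X)))"
      using cS le by (intro mult_left_mono) auto
    ultimately show ?thesis by simp
  qed
  have bad: "measure_pmf.prob ?Q (?bad L R) \<le> ?\<eta>" "measure_pmf.prob ?Q (?bad R L) \<le> ?\<eta>"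
    using prob_one_sided_expansion_fails[OF fin disj card \<rho> b b_large n]
      prob_one_sided_expansion_fails[OF fin(2,1) _ card(2,1) \<rho> b b_large n] disj
    unfolding perfect_matchings_commute[of R L] by (simp_all only: Int_commute[of R L])
  have "measure_pmf.prob ?Q (- ?good) \<le> measure_pmf.prob ?Q (?bad L R \<union> ?bad R L)"
  \<comment> \<open>The inclusion is proved on the support only. There the union of the matchings is
    finite, as the comparison of cardinalities requires: \<open>card\<close> of an infinite set is
    0.\<close>
  proof (rule measure_pmf.finite_measure_mono_AE, unfold AE_measure_pmf_iff, intro ballI impI)
    fix M assume MQ: "M \<in> set_pmf ?Q" and M: "M \<in> - ?good"
    have PM: "M k \<in> perfect_matchings L R" if "k < n" for k
      using MQ fin disj card that
      by (auto simp: set_Pi_pmf PiE_dflt_def finite_perfect_matchings perfect_matchings_nonempty)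
    have "(\<Union>k<n. M k) \<subseteq> Pow (L \<union> R)"
      using perfect_matching_edgeE[OF PM] by blast
    then have finG: "finite (\<Union>k<n. M k)" using fin by (meson finite_Pow_iff finite_UnI finite_subset)
    from M obtain S where S: "S \<subseteq> L \<union> R" "2 * card S \<le> card (L \<union> R)"
      and viol: "\<not> real n / 50 * real (card S) \<le> real (card {e \<in> (\<Union>k<n. M k). e \<inter> S \<noteq> {} \<and> \<not> e \<subseteq> S})"
      unfolding edge_expanding_def by blast
    show "M \<in> ?bad L R \<union> ?bad R L"
    proof (rule ccontr)
      assume nb: "M \<notin> ?bad L R \<union> ?bad R L"
      show False
      proof (cases "card (S \<inter> R) \<le> card (S \<inter> L)")
        case True
        with one_side[of M L R S, OF _ refl disj S True refl finG] nb viol show False by blast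
      next
        case False
        then have "card (S \<inter> L) \<le> card (S \<inter> R)" by simp
        from one_side[of M R L S, OF _ Un_commute _ S this refl finG] nb viol disj show False
          by blast
      qed
    qed
  qed auto
  also have "\<dots> \<le> measure_pmf.prob ?Q (?bad L R) + measure_pmf.prob ?Q (?bad R L)"
    by (rule measure_subadditive) auto
  also have "\<dots> \<le> 2 * ?\<eta>" using bad by linarith
  finally have "measure_pmf.prob ?Q (- ?good) \<le> 2 * ?\<eta>" .
  moreover have "measure_pmf.prob ?Q (- ?good) = 1 - measure_pmf.prob ?Q ?good"
    using measure_pmf.prob_compl[of ?good ?Q] by (simp add: Compl_eq_Diff_UNIV)
  ultimately show ?thesis by linarith
qed

text \<open>When all vertices are ports the outer matchings live on empty sets, so each is the empty
  matching and only the inner ones remain.\<close>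

lemma random_port_graph_all_ports:
  assumes fin: "finite L" "finite R" and disj: "L \<inter> R = {}" and card: "card L = b" "card R = b"
  shows "random_port_graph L R b n k = map_pmf (\<lambda>M. (L \<union> R, \<Union>k<n. M k))
    (Pi_pmf {..<n} {} (\<lambda>_. pmf_of_set (perfect_matchings L R)))"
proof -
  have "P = L \<union> R" if "P \<in> port_sets L R b" for P
  proof -
    have "P \<subseteq> L \<union> R" "card (P \<inter> L) = card L" "card (P \<inter> R) = card R"
      using that card by (auto simp: port_sets_def)
    then have "P \<inter> L = L" "P \<inter> R = R" using fin by (metis card_subset_eq inf_le2)+
    then show ?thesis using \<open>P \<subseteq> L \<union> R\<close> by auto
  qed
  moreover have "L \<union> R \<in> port_sets L R b"
    using card by (auto simp: port_sets_def Int_absorb1)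
  ultimately have "port_sets L R b = {L \<union> R}" by blast
  \<comment> \<open>The second product is concentrated on one function: \<open>{}\<close> on the
    index set, and the default value \<open>{}\<close> outside it.\<close>
  moreover have "(\<Union>i<k. if i < k then {} else {}) = {}" by simp
  ultimately show ?thesis
    by (simp add: random_port_graph_def pmf_of_set_singleton bind_return_pmf map_pmf_def
        perfect_matchings_empty Diff_eq_empty_iff[THEN iffD2])
qed

section \<open>The Potts model on an expanding gadget\<close>

lemma obtain_argmax:
  fixes f :: "'b \<Rightarrow> nat"
  assumes "finite I" "I \<noteq> {}"
  obtains i where "i \<in> I" "\<And>j. j \<in> I \<Longrightarrow> f j \<le> f i"
proof -
  have "Max (f ` I) \<in> f ` I" using assms by (intro Max_in) auto
  then obtain i where i: "i \<in> I" "Max (f ` I) = f i" by auto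
  show thesis
  proof (rule that[OF i(1)])
    show "f j \<le> f i" if "j \<in> I" for j
      unfolding i(2)[symmetric] using assms that by (intro Max_ge) auto
  qed
qed

text \<open>Double counting: an edge cut by a colour class is bichromatic or leaves
  \<open>W\<close>, and, having at most two ends, it is cut by the classes of at most two
  colours.\<close>

lemma sum_card_cuts_le:
  assumes finG: "finite G" and G: "\<And>e. e \<in> G \<Longrightarrow> \<exists>u v. e = {u, v}" and finJ: "finite J"
  shows "(\<Sum>j\<in>J. card {e \<in> G. e \<inter> {v \<in> W. \<sigma> v = j} \<noteq> {} \<and> \<not> e \<subseteq> {v \<in> W. \<sigma> v = j}})
    \<le> 2 * card {e \<in> G. \<not> (e \<subseteq> W \<and> (\<forall>u\<in>e. \<forall>v\<in>e. \<sigma> u = \<sigma> v))}"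
proof -
  let ?cut = "\<lambda>j e. e \<inter> {v \<in> W. \<sigma> v = j} \<noteq> {} \<and> \<not> e \<subseteq> {v \<in> W. \<sigma> v = j}"
  let ?Bi = "{e \<in> G. \<not> (e \<subseteq> W \<and> (\<forall>u\<in>e. \<forall>v\<in>e. \<sigma> u = \<sigma> v))}"
  have "(\<Sum>j\<in>J. card {e \<in> G. ?cut j e}) = (\<Sum>j\<in>J. card {e \<in> ?Bi. ?cut j e})"
    by (intro sum.cong arg_cong[where f = card]) auto
  also have "\<dots> = (\<Sum>e\<in>?Bi. card {j \<in> J. ?cut j e})"
    using finG finJ by (intro sum_multicount_gen) auto
  also have "\<dots> \<le> (\<Sum>e\<in>?Bi. 2)"
  proof (rule sum_mono)
    fix e assume "e \<in> ?Bi"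
    then obtain u v where e: "e = {u, v}" using G by blast
    have "card {j \<in> J. ?cut j e} \<le> card {\<sigma> u, \<sigma> v}"
      unfolding e by (rule card_mono) auto
    also have "\<dots> \<le> 2" by (simp add: card_insert_if)
    finally show "card {j \<in> J. ?cut j e} \<le> 2" .
  qed
  finally show ?thesis by simp
qed

text \<open>Take \<open>i\<close> to be the most frequent colour. Any other class is disjoint from
  this class, which is at least as large, so it fills at most half of \<open>W\<close> and expands.
  Adding up, each bichromatic edge is counted at most twice, whence
  \<open>\<gamma> / 2\<close>.\<close>

lemma edge_expanding_bichromatic:
  assumes finW: "finite W" and exp: "edge_expanding W G \<gamma>" and finG: "finite G"
    and G: "\<And>e. e \<in> G \<Longrightarrow> e \<subseteq> W \<and> (\<exists>u v. e = {u, v})"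
    and \<sigma>: "\<And>v. v \<in> W \<Longrightarrow> \<sigma> v \<in> I" and I: "finite I" "I \<noteq> {}" and \<gamma>: "0 \<le> \<gamma>"
  obtains i where "i \<in> I"
    "\<gamma> / 2 * real (card {v \<in> W. \<sigma> v \<noteq> i}) \<le> real (card {e \<in> G. \<not> (\<forall>u\<in>e. \<forall>v\<in>e. \<sigma> u = \<sigma> v)})"
proof -
  let ?S = "\<lambda>j. {v \<in> W. \<sigma> v = j}"
  let ?cut = "\<lambda>j. {e \<in> G. e \<inter> ?S j \<noteq> {} \<and> \<not> e \<subseteq> ?S j}"
  obtain i where i: "i \<in> I" and max: "\<And>j. j \<in> I \<Longrightarrow> card (?S j) \<le> card (?S i)"
    using obtain_argmax[OF I, of "\<lambda>j. card (?S j)"] by blast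
  have half: "2 * card (?S j) \<le> card W" if "j \<in> I - {i}" for j
  proof -
    have "card (?S j) + card (?S i) = card (?S j \<union> ?S i)"
      using finW that by (intro card_Un_disjoint[symmetric]) auto
    also have "\<dots> \<le> card W" using finW by (intro card_mono) auto
    finally show ?thesis using max[of j] that by simp
  qed
  have "{v \<in> W. \<sigma> v \<noteq> i} = (\<Union>j\<in>I - {i}. ?S j)" using \<sigma> by auto
  then have "card {v \<in> W. \<sigma> v \<noteq> i} \<le> (\<Sum>j\<in>I - {i}. card (?S j))"
    using card_UN_le[of "I - {i}" ?S] I by simp
  then have "\<gamma> * real (card {v \<in> W. \<sigma> v \<noteq> i}) \<le> \<gamma> * real (\<Sum>j\<in>I - {i}. card (?S j))"
    using \<gamma> by (intro mult_left_mono of_nat_mono)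
  also have "\<dots> = (\<Sum>j\<in>I - {i}. \<gamma> * real (card (?S j)))" by (simp add: sum_distrib_left)
  also have "\<dots> \<le> (\<Sum>j\<in>I - {i}. real (card (?cut j)))"
    using exp half unfolding edge_expanding_def by (intro sum_mono) auto
  also have "\<dots> \<le> 2 * real (card {e \<in> G. \<not> (e \<subseteq> W \<and> (\<forall>u\<in>e. \<forall>v\<in>e. \<sigma> u = \<sigma> v))})"
  proof -
    have "(\<Sum>j\<in>I - {i}. card (?cut j))
      \<le> 2 * card {e \<in> G. \<not> (e \<subseteq> W \<and> (\<forall>u\<in>e. \<forall>v\<in>e. \<sigma> u = \<sigma> v))}"
      by (rule sum_card_cuts_le[OF finG]) (use G I in blast)+
    from of_nat_mono[OF this, where 'a = real] show ?thesis
      by (simp only: of_nat_sum of_nat_mult of_nat_numeral)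
  qed
  also have "{e \<in> G. \<not> (e \<subseteq> W \<and> (\<forall>u\<in>e. \<forall>v\<in>e. \<sigma> u = \<sigma> v))} = {e \<in> G. \<not> (\<forall>u\<in>e. \<forall>v\<in>e. \<sigma> u = \<sigma> v)}"
    using G by auto
  finally show thesis using that[OF i] by simp
qed

lemma potts_weight_le_monochromatic:
  fixes h \<beta>\<^sub>B \<gamma> :: real
  assumes att: "attached_via_ports W G P d_out V E" and finW: "finite W"
    and exp: "edge_expanding W G \<gamma>" and \<gamma>: "0 \<le> \<gamma>"
    and \<beta>B: "0 < \<beta>\<^sub>B" and \<beta>in: "\<And>e. e \<in> G \<Longrightarrow> \<beta> e = \<beta>\<^sub>B" and \<beta>out: "\<And>e. e \<in> E - G \<Longrightarrow> \<bar>\<beta> e\<bar> \<le> \<beta>\<^sub>B"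
    and \<sigma>: "\<sigma> \<in> configs V q" and q: "1 \<le> q"
    and H: "H = (\<lambda>v i. h * of_bool (i = \<kappa>) * of_bool (v \<in> W))"
  obtains i where "i \<in> {1..q}"
    "potts_weight V E \<beta> H \<sigma> \<le> potts_weight V E \<beta> H (\<lambda>v. if v \<in> W then i else \<sigma> v) *
       exp (\<bar>h\<bar> - \<beta>\<^sub>B * (\<gamma> / 2 - real d_out)) ^ card {v \<in> W. \<sigma> v \<noteq> i}"
proof -
  let ?mono = "\<lambda>(\<tau>::'a \<Rightarrow> nat) e. \<forall>u\<in>e. \<forall>v\<in>e. \<tau> u = \<tau> v"
  have finV: "finite V" and WV: "W \<subseteq> V" and GE: "G = {e \<in> E. e \<subseteq> W}"
    and E: "E \<subseteq> {{u, v} | u v. u \<in> V \<and> v \<in> V \<and> u \<noteq> v}"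
    using att by (auto simp: attached_via_ports_def simple_graph_def induced_subgraph_def)
  have "E \<subseteq> Pow V" using E by auto
  then have finE: "finite E" using finV finite_subset by blast
  have Ge: "e \<subseteq> W \<and> (\<exists>u v. e = {u, v})" if "e \<in> G" for e using that E GE by blast
  have \<sigma>q: "\<sigma> v \<in> {1..q}" if "v \<in> W" for v using that \<sigma> WV by (auto simp: configs_def)
  have finG: "finite G" using finE GE by simp
  obtain i where i: "i \<in> {1..q}"
    and bi: "\<gamma> / 2 * real (card {v \<in> W. \<sigma> v \<noteq> i}) \<le> real (card {e \<in> G. \<not> ?mono \<sigma> e})"
  proof (rule edge_expanding_bichromatic[OF finW exp finG Ge _ _ _ \<gamma>, of \<sigma> "{1..q}"])
  qed (use \<sigma>q q that in auto)
  define S where "S = {v \<in> W. \<sigma> v \<noteq> i}"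
  define \<sigma>' where "\<sigma>' = (\<lambda>v. if v \<in> W then i else \<sigma> v)"
  have finS: "finite S" using finW by (simp add: S_def)
  have out: "card {e \<in> E - G. e \<inter> S \<noteq> {}} \<le> d_out * card S"
  proof -
    let ?N = "\<lambda>v. {u \<in> V - W. {u, v} \<in> E}"
    have deg: "card (?N v) \<le> d_out" if "v \<in> S" for v
    proof (cases "v \<in> P")
      case True
      then show ?thesis using att by (auto simp: attached_via_ports_def)
    next
      case False
      then have "?N v = {}" using that att by (auto simp: attached_via_ports_def S_def)
      then show ?thesis by (simp only: card.empty)
    qed
    \<comment> \<open>An edge outside \<open>G\<close> that meets \<open>S\<close> has its other end
      outside \<open>W\<close>, because \<open>G\<close> contains every edge inside
      \<open>W\<close>.\<close>
    have "{e \<in> E - G. e \<inter> S \<noteq> {}} \<subseteq> (\<Union>v\<in>S. (\<lambda>u. {u, v}) ` ?N v)"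
    proof
      fix e assume e: "e \<in> {e \<in> E - G. e \<inter> S \<noteq> {}}"
      then obtain v where v: "v \<in> e" "v \<in> S" by auto
      from e E obtain x y where xy: "e = {x, y}" "x \<in> V" "y \<in> V" by blast
      then obtain u where u: "e = {u, v}" "u \<in> V" using v(1) by blast
      have "u \<notin> W" using e u v GE by (auto simp: S_def)
      then show "e \<in> (\<Union>v\<in>S. (\<lambda>u. {u, v}) ` ?N v)" using e u v by blast
    qed
    then have "card {e \<in> E - G. e \<inter> S \<noteq> {}} \<le> card (\<Union>v\<in>S. (\<lambda>u. {u, v}) ` ?N v)"
      using finS finV by (intro card_mono) auto
    also have "\<dots> \<le> (\<Sum>v\<in>S. card ((\<lambda>u. {u, v}) ` ?N v))" by (rule card_UN_le[OF finS])
    also have "\<dots> \<le> (\<Sum>v\<in>S. d_out)"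
    proof (rule sum_mono)
      fix v assume "v \<in> S"
      then show "card ((\<lambda>u. {u, v}) ` ?N v) \<le> d_out"
        using deg[of v] card_image_le[of "?N v" "\<lambda>u. {u, v}"] finV by simp
    qed
    finally show ?thesis by (simp add: mult.commute)
  qed
  have "(\<Sum>e\<in>E. \<beta> e * of_bool (?mono \<sigma> e)) - (\<Sum>e\<in>E. \<beta> e * of_bool (?mono \<sigma>' e))
      = (\<Sum>e\<in>E. \<beta> e * of_bool (?mono \<sigma> e) - \<beta> e * of_bool (?mono \<sigma>' e))"
    by (simp add: sum_subtractf)
  \<comment> \<open>Edge by edge: an inner edge is monochromatic after recolouring, so it changes by
    0 or by \<open>- \<beta>\<^sub>B\<close>; an outer edge changes only if it meets
    \<open>S\<close>, and then by at most \<open>\<beta>\<^sub>B\<close>.\<close>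
  also have "\<dots> \<le> (\<Sum>e\<in>E. \<beta>\<^sub>B * of_bool (e \<in> E - G \<and> e \<inter> S \<noteq> {}) - \<beta>\<^sub>B * of_bool (e \<in> G \<and> \<not> ?mono \<sigma> e))"
  proof (rule sum_mono)
    fix e assume e: "e \<in> E"
    define r r' where "r = ?mono \<sigma> e" and "r' = ?mono \<sigma>' e"
    have "\<beta> e * of_bool r - \<beta> e * of_bool r'
      \<le> \<beta>\<^sub>B * of_bool (e \<in> E - G \<and> e \<inter> S \<noteq> {}) - \<beta>\<^sub>B * of_bool (e \<in> G \<and> \<not> r)"
    proof (cases "e \<in> G")
      case True
      then have r' unfolding r'_def \<sigma>'_def using Ge by (simp add: subset_iff)
      then show ?thesis using True \<beta>in[OF True] by (cases r) auto
    next
      case False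
      show ?thesis
      proof (cases "e \<inter> S = {}")
        case True
        then have "\<And>v. v \<in> e \<Longrightarrow> \<sigma>' v = \<sigma> v" by (auto simp: \<sigma>'_def S_def)
        then have "r' \<longleftrightarrow> r" by (simp add: r_def r'_def)
        then show ?thesis using True False by simp
      next
        case ne: False
        have "\<bar>\<beta> e\<bar> \<le> \<beta>\<^sub>B" using \<beta>out e False by blast
        then show ?thesis using ne False e \<beta>B
          by (cases r; cases r') (simp_all add: abs_le_iff)
      qed
    qed
    then show "\<beta> e * of_bool (?mono \<sigma> e) - \<beta> e * of_bool (?mono \<sigma>' e)
      \<le> \<beta>\<^sub>B * of_bool (e \<in> E - G \<and> e \<inter> S \<noteq> {}) - \<beta>\<^sub>B * of_bool (e \<in> G \<and> \<not> ?mono \<sigma> e)"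
      by (simp only: r_def r'_def)
  qed
  also have "\<dots> = \<beta>\<^sub>B * real (card {e \<in> E - G. e \<inter> S \<noteq> {}}) - \<beta>\<^sub>B * real (card {e \<in> G. \<not> ?mono \<sigma> e})"
  proof -
    have "E \<inter> {e. e \<in> E - G \<and> e \<inter> S \<noteq> {}} = {e \<in> E - G. e \<inter> S \<noteq> {}}"
      "E \<inter> {e. e \<in> G \<and> \<not> ?mono \<sigma> e} = {e \<in> G. \<not> ?mono \<sigma> e}" using GE by auto
    then show ?thesis using finE
      by (simp only: sum_subtractf sum_distrib_left[symmetric] sum_of_bool_eq)
  qed
  also have "\<dots> \<le> \<beta>\<^sub>B * (real d_out * real (card S)) - \<beta>\<^sub>B * (\<gamma> / 2 * real (card S))"
    using out bi \<beta>B of_nat_mono[OF out, where 'a = real]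
    by (intro diff_mono mult_left_mono) (auto simp: S_def)
  finally have edges: "(\<Sum>e\<in>E. \<beta> e * of_bool (?mono \<sigma> e)) - (\<Sum>e\<in>E. \<beta> e * of_bool (?mono \<sigma>' e))
      \<le> \<beta>\<^sub>B * (real d_out * real (card S)) - \<beta>\<^sub>B * (\<gamma> / 2 * real (card S))" .
  have "(\<Sum>v\<in>V. H v (\<sigma> v)) - (\<Sum>v\<in>V. H v (\<sigma>' v)) = (\<Sum>v\<in>V. H v (\<sigma> v) - H v (\<sigma>' v))"
    by (simp add: sum_subtractf)
  also have "\<dots> \<le> (\<Sum>v\<in>V. \<bar>h\<bar> * of_bool (v \<in> S))"
    by (intro sum_mono) (auto simp: H S_def \<sigma>'_def)
  also have "\<dots> = \<bar>h\<bar> * real (card S)"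
  proof -
    have "V \<inter> {v. v \<in> S} = S" using WV by (auto simp: S_def)
    then show ?thesis using finV by (simp only: sum_distrib_left[symmetric] sum_of_bool_eq)
  qed
  finally have field: "(\<Sum>v\<in>V. H v (\<sigma> v)) - (\<Sum>v\<in>V. H v (\<sigma>' v)) \<le> \<bar>h\<bar> * real (card S)" .
  have "potts_weight V E \<beta> H \<sigma> \<le> potts_weight V E \<beta> H \<sigma>' *
       exp (real (card S) * (\<bar>h\<bar> - \<beta>\<^sub>B * (\<gamma> / 2 - real d_out)))"
    unfolding potts_weight_def exp_add[symmetric] exp_le_cancel_iff
    using edges field by (simp add: algebra_simps)
  then show thesis using that[OF i] by (simp add: exp_of_nat_mult S_def \<sigma>'_def)
qed

section \<open>Conditional probability of the monochromatic configurations\<close>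

lemma prob_potts:
  assumes "finite V" "1 \<le> q"
  shows "measure_pmf.prob (potts q V E \<beta> H) X
    = (\<Sum>\<sigma>\<in>configs V q \<inter> X. potts_weight V E \<beta> H \<sigma>) / potts_Z q V E \<beta> H"
proof -
  have "measure_pmf.prob (potts q V E \<beta> H) X = measure_pmf.prob (potts q V E \<beta> H) (configs V q \<inter> X)"
    by (rule measure_prob_cong_0) (auto simp: pmf_potts[OF assms])
  also have "\<dots> = (\<Sum>\<sigma>\<in>configs V q \<inter> X. pmf (potts q V E \<beta> H) \<sigma>)"
    using finite_configs[OF assms(1)] by (intro measure_measure_pmf_finite) auto
  also have "\<dots> = (\<Sum>\<sigma>\<in>configs V q \<inter> X. potts_weight V E \<beta> H \<sigma> / potts_Z q V E \<beta> H)"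
    by (intro sum.cong) (auto simp: pmf_potts[OF assms])
  finally show ?thesis by (simp add: sum_divide_distrib)
qed

text \<open>The sum factorises over the vertices, each contributing
  \<open>1 + (q - 1) * y\<close>.\<close>

lemma sum_power_card_disagreements:
  fixes y :: real
  assumes "finite W" "i \<in> {1..q}" "0 \<le> y"
  shows "(\<Sum>\<xi>\<in>W \<rightarrow>\<^sub>E {1..q}. y ^ card {v \<in> W. \<xi> v \<noteq> i}) \<le> (1 + real q * y) ^ card W"
proof -
  have "(\<Sum>\<xi>\<in>W \<rightarrow>\<^sub>E {1..q}. y ^ card {v \<in> W. \<xi> v \<noteq> i})
    = (\<Sum>\<xi>\<in>W \<rightarrow>\<^sub>E {1..q}. \<Prod>v\<in>W. if \<xi> v \<noteq> i then y else 1)"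
    using assms by (intro sum.cong) (auto simp: prod.If_cases Int_def)
  also have "\<dots> = (\<Prod>v\<in>W. \<Sum>j=1..q. if j \<noteq> i then y else 1)"
    using assms by (subst prod_sum_PiE) auto
  also have "\<dots> = (\<Sum>j=1..q. if j \<noteq> i then y else 1) ^ card W" by simp
  also have "\<dots> \<le> (1 + real q * y) ^ card W"
  proof (intro power_mono sum_nonneg)
    have "(\<Sum>j=1..q. if j \<noteq> i then y else 1) \<le> (\<Sum>j=1..q. y + of_bool (j = i))"
      using assms by (intro sum_mono) auto
    also have "\<dots> = real q * y + 1"
      using assms by (simp add: sum.distrib sum_of_bool_eq)
    finally show "(\<Sum>j=1..q. if j \<noteq> i then y else 1) \<le> 1 + real q * y" by simp
  qed (use assms in auto)
  finally show ?thesis .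
qed

text \<open>In the conditional probability the partition function cancels, leaving a ratio of
  weights. Every configuration compatible with \<open>\<tau>\<close> is charged to a monochromatic
  one, \<open>s i\<close>. For fixed \<open>i\<close> the charges add up to a power sum over
  disagreement sets, since such a configuration is determined by its restriction to
  \<open>W\<close>.\<close>

lemma cond_prob_potts_monochromatic_ge:
  fixes y :: real
  assumes finV: "finite V" and WV: "W \<subseteq> V" and W: "W \<noteq> {}" and q: "1 \<le> q" and y: "0 \<le> y"
    and \<tau>: "\<tau> \<in> configs (V - W) q"
    and compare: "\<And>\<sigma>. \<sigma> \<in> configs V q \<Longrightarrow> \<exists>i\<in>{1..q}. potts_weight V E \<beta> H \<sigma> \<le>
      potts_weight V E \<beta> H (\<lambda>v. if v \<in> W then i else \<sigma> v) * y ^ card {v \<in> W. \<sigma> v \<noteq> i}"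
  shows "\<P>(\<sigma> in measure_pmf (potts q V E \<beta> H).
      \<exists>i\<in>{1..q}. restrict \<sigma> W = mono_config W i \<bar> restrict \<sigma> (V - W) = \<tau>)
    \<ge> 1 / (1 + real q * y) ^ card W"
proof -
  let ?w = "potts_weight V E \<beta> H"
  define \<Omega> where "\<Omega> = configs V q \<inter> {\<sigma>. restrict \<sigma> (V - W) = \<tau>}"
  define \<Omega>' where "\<Omega>' = configs V q \<inter> {\<sigma>. (\<exists>i\<in>{1..q}. restrict \<sigma> W = mono_config W i) \<and>
    restrict \<sigma> (V - W) = \<tau>}"
  define s where "s = (\<lambda>i v. if v \<in> W then i else \<tau> v)"
  have finW: "finite W" using finV WV finite_subset by blast
  have fin: "finite \<Omega>" "finite \<Omega>'"
    using finite_configs[OF finV] by (auto simp: \<Omega>_def \<Omega>'_def)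
  have s: "s i \<in> \<Omega>'" if i: "i \<in> {1..q}" for i
  proof -
    have "s i \<in> configs V q"
      using i \<tau> WV by (auto simp: configs_def s_def PiE_iff extensional_def)
    moreover have "restrict (s i) W = mono_config W i"
      by (auto simp: mono_config_def s_def restrict_def)
    moreover have "restrict (s i) (V - W) = \<tau>"
      using \<tau> by (auto simp: s_def restrict_def configs_def PiE_iff extensional_def)
    ultimately show ?thesis using i by (auto simp: \<Omega>'_def)
  qed
  have override: "(\<lambda>v. if v \<in> W then i else \<sigma> v) = s i" if "\<sigma> \<in> \<Omega>" for \<sigma> i
  proof
    fix v
    have \<sigma>: "restrict \<sigma> (V - W) = \<tau>" "\<sigma> \<in> extensional V"
      using that by (auto simp: \<Omega>_def configs_def PiE_iff)
    show "(if v \<in> W then i else \<sigma> v) = s i v"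
      using \<sigma> by (auto simp: s_def restrict_def extensional_def)
  qed
  \<comment> \<open>This needs \<open>W\<close> to be nonempty; otherwise all \<open>s i\<close>
    coincide and a sum over \<open>i\<close> would count one configuration \<open>q\<close>
    times.\<close>
  have inj_s: "inj_on s {1..q}"
  proof (rule inj_onI)
    fix i j assume "s i = s j"
    moreover obtain v where "v \<in> W" using W by blast
    ultimately show "i = j" by (auto simp: s_def dest: fun_cong[of _ _ v])
  qed
  have inj_r: "inj_on (\<lambda>\<sigma>. restrict \<sigma> W) \<Omega>"
  proof (rule inj_onI)
    fix \<sigma> \<sigma>' assume a: "\<sigma> \<in> \<Omega>" "\<sigma>' \<in> \<Omega>" "restrict \<sigma> W = restrict \<sigma>' W"
    show "\<sigma> = \<sigma>'"
    proof
      fix v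
      have "restrict \<sigma> (V - W) v = restrict \<sigma>' (V - W) v" using a by (auto simp: \<Omega>_def)
      moreover have "restrict \<sigma> W v = restrict \<sigma>' W v" using a by simp
      moreover have "\<sigma> \<in> extensional V" "\<sigma>' \<in> extensional V"
        using a by (auto simp: \<Omega>_def configs_def PiE_iff)
      ultimately show "\<sigma> v = \<sigma>' v"
        by (cases "v \<in> V"; cases "v \<in> W") (auto simp: extensional_def)
    qed
  qed
  have disagree: "(\<Sum>\<sigma>\<in>\<Omega>. y ^ card {v \<in> W. \<sigma> v \<noteq> i}) \<le> (1 + real q * y) ^ card W"
    if i: "i \<in> {1..q}" for i
  proof -
    have "(\<Sum>\<sigma>\<in>\<Omega>. y ^ card {v \<in> W. \<sigma> v \<noteq> i})
        = (\<Sum>\<sigma>\<in>\<Omega>. y ^ card {v \<in> W. restrict \<sigma> W v \<noteq> i})"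
      by (intro sum.cong refl arg_cong2[where f = power] arg_cong[where f = card]) auto
    also have "\<dots> = (\<Sum>\<xi>\<in>(\<lambda>\<sigma>. restrict \<sigma> W) ` \<Omega>. y ^ card {v \<in> W. \<xi> v \<noteq> i})"
      using inj_r by (simp add: sum.reindex)
    also have "\<dots> \<le> (\<Sum>\<xi>\<in>W \<rightarrow>\<^sub>E {1..q}. y ^ card {v \<in> W. \<xi> v \<noteq> i})"
      using WV finW y by (intro sum_mono2) (auto simp: finite_PiE \<Omega>_def configs_def PiE_iff)
    also have "\<dots> \<le> (1 + real q * y) ^ card W"
      by (rule sum_power_card_disagreements[OF finW i y])
    finally show ?thesis .
  qed
  have wpos: "0 < ?w \<sigma>" for \<sigma> by (simp add: potts_weight_def)
  \<comment> \<open>Adding the terms of all spins removes the dependence of \<open>i\<close> on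
    \<open>\<sigma>\<close>, so that the two sums can be exchanged.\<close>
  have "(\<Sum>\<sigma>\<in>\<Omega>. ?w \<sigma>) \<le> (\<Sum>\<sigma>\<in>\<Omega>. \<Sum>i=1..q. ?w (s i) * y ^ card {v \<in> W. \<sigma> v \<noteq> i})"
  proof (rule sum_mono)
    fix \<sigma> assume \<sigma>: "\<sigma> \<in> \<Omega>"
    then obtain i where i: "i \<in> {1..q}" and le: "?w \<sigma> \<le> ?w (s i) * y ^ card {v \<in> W. \<sigma> v \<noteq> i}"
      using compare[of \<sigma>] override[OF \<sigma>] by (auto simp: \<Omega>_def)
    note le
    also have "?w (s i) * y ^ card {v \<in> W. \<sigma> v \<noteq> i} \<le> (\<Sum>i=1..q. ?w (s i) * y ^ card {v \<in> W. \<sigma> v \<noteq> i})"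
      using i y less_imp_le[OF wpos] by (intro member_le_sum) auto
    finally show "?w \<sigma> \<le> (\<Sum>i=1..q. ?w (s i) * y ^ card {v \<in> W. \<sigma> v \<noteq> i})" .
  qed
  also have "\<dots> = (\<Sum>i=1..q. ?w (s i) * (\<Sum>\<sigma>\<in>\<Omega>. y ^ card {v \<in> W. \<sigma> v \<noteq> i}))"
    by (subst sum.swap) (simp add: sum_distrib_left)
  also have "\<dots> \<le> (\<Sum>i=1..q. ?w (s i) * (1 + real q * y) ^ card W)"
    using wpos by (intro sum_mono mult_left_mono disagree) (auto intro: less_imp_le)
  also have "\<dots> = (\<Sum>\<sigma>\<in>s ` {1..q}. ?w \<sigma>) * (1 + real q * y) ^ card W"
    using inj_s by (simp add: sum.reindex sum_distrib_right)
  also have "\<dots> \<le> (\<Sum>\<sigma>\<in>\<Omega>'. ?w \<sigma>) * (1 + real q * y) ^ card W"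
    using s fin wpos y by (intro mult_right_mono sum_mono2) (auto intro: less_imp_le)
  finally have main: "(\<Sum>\<sigma>\<in>\<Omega>. ?w \<sigma>) \<le> (\<Sum>\<sigma>\<in>\<Omega>'. ?w \<sigma>) * (1 + real q * y) ^ card W" .
  have "\<Omega>' \<subseteq> \<Omega>" by (auto simp: \<Omega>_def \<Omega>'_def)
  then have "\<Omega> \<noteq> {}" using s[of 1] q by auto
  then have pos: "0 < (\<Sum>\<sigma>\<in>\<Omega>. ?w \<sigma>)" using fin wpos by (intro sum_pos) auto
  have "0 < (1 + real q * y) ^ card W" using y by (intro zero_less_power) (simp add: add_pos_nonneg)
  then have "1 / (1 + real q * y) ^ card W \<le> (\<Sum>\<sigma>\<in>\<Omega>'. ?w \<sigma>) / (\<Sum>\<sigma>\<in>\<Omega>. ?w \<sigma>)"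
    using main pos by (simp add: field_simps)
  also have "\<dots> = \<P>(\<sigma> in measure_pmf (potts q V E \<beta> H).
      \<exists>i\<in>{1..q}. restrict \<sigma> W = mono_config W i \<bar> restrict \<sigma> (V - W) = \<tau>)"
    using potts_Z_pos[OF finV q, of E \<beta> H]
    by (simp add: cond_prob_def prob_potts[OF finV q] \<Omega>_def \<Omega>'_def)
  finally show ?thesis .
qed

section \<open>Choice of the constants and conclusion\<close>

lemma union_bound_tendsto_0:
  "(\<lambda>b::nat. 2 * (real b * real (b + 1) * (real b powr (- 3) + 2 powr (- sqrt b)))) \<longlonglongrightarrow> 0"
  by real_asymp

theorem theorem5p4:
  fixes \<rho> :: real
  assumes "0 < \<rho>" and "\<rho> < 1"
  shows
    "\<exists>\<delta>>0. \<exists>\<theta>. 0 < \<theta> \<and> \<theta> < 1 \<and>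
       (\<exists>\<epsilon> :: nat \<Rightarrow> real. \<epsilon> \<longlonglongrightarrow> 0 \<and>
         (\<forall>(b::nat) (p::nat) (d::nat) (d_in::nat) (d_out::nat) (q::nat) (\<kappa>::nat)
            (\<beta>_B::real) (h::real) (L::'a set) (R::'a set).
            finite L \<and> finite R \<and> L \<inter> R = {} \<and> card L = b \<and> card R = b \<and>
            p = b \<and> 4 + 1200 / \<rho> \<le> real d \<and> real d \<le> real b powr (1 - \<rho>) \<and>
            d_in = nat \<lfloor>\<theta> * real d\<rfloor> \<and> d_out = d - nat \<lfloor>\<theta> * real d\<rfloor> \<and>
            \<kappa> \<in> {1..q} \<and> \<beta>_B > 0 \<and>
            0 \<le> 1 - (real q)\<^sup>2 * exp (2 * \<bar>h\<bar>) / exp (\<delta> * \<beta>_B * real d)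
            \<longrightarrow>
            measure_pmf.prob (random_port_graph L R p d_in d_out)
              {(P, E_B). \<forall>V E \<beta> \<tau>.
                 attached_via_ports (L \<union> R) E_B P d_out V E \<and>
                 (\<forall>e \<in> E_B. \<beta> e = \<beta>_B) \<and> (\<forall>e \<in> E - E_B. \<bar>\<beta> e\<bar> \<le> \<beta>_B) \<and>
                 \<tau> \<in> configs (V - (L \<union> R)) q
                 \<longrightarrow>
                 \<P>(\<sigma> in measure_pmf (potts q V E \<beta> (\<lambda>v i. h * of_bool (i = \<kappa>) * of_bool (v \<in> L \<union> R))).
                      \<exists>i \<in> {1..q}. restrict \<sigma> (L \<union> R) = mono_config (L \<union> R) i
                      \<bar> restrict \<sigma> (V - (L \<union> R)) = \<tau>)
                 \<ge> (1 - (real q)\<^sup>2 * exp (2 * \<bar>h\<bar>) / exp (\<delta> * \<beta>_B * real d)) ^ (2 * b)}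
            \<ge> 1 - \<epsilon> b))"
proof -
  \<comment> \<open>So close to 1 that \<open>d_out\<close>, at most \<open>d / 1000 + 1\<close>, is
    outweighed by the gain \<open>d_in / 100\<close> with \<open>d / 200\<close> to spare; this
    explains \<delta> = 1/200. As \<open>d\<close> exceeds 1200, the rounding does no harm.\<close>
  define \<theta> :: real where "\<theta> = 999 / 1000"
  \<comment> \<open>For the finitely many small \<open>b\<close> the value 1 makes the claim
    trivial.\<close>
  define \<epsilon> where "\<epsilon> = (\<lambda>b::nat. if 3 \<le> b \<and> real b powr (- \<rho> / 4) \<le> 1 / 6
    then 2 * (real b * real (b + 1) * (real b powr (- 3) + 2 powr (- sqrt b))) else 1)"
  have "eventually (\<lambda>b::nat. 3 \<le> b \<and> real b powr (- \<rho> / 4) \<le> 1 / 6) sequentially"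
    using assms by (intro eventually_conj eventually_ge_at_top) real_asymp
  then have "eventually (\<lambda>b. \<epsilon> b =
      2 * (real b * real (b + 1) * (real b powr (- 3) + 2 powr (- sqrt b)))) sequentially"
    by eventually_elim (simp add: \<epsilon>_def)
  then have \<epsilon>0: "\<epsilon> \<longlonglongrightarrow> 0"
    using union_bound_tendsto_0 by (simp add: filterlim_cong)
  show ?thesis
  proof (rule exI[of _ "1 / 200"], intro conjI, simp, rule exI[of _ \<theta>], intro conjI,
      simp add: \<theta>_def, simp add: \<theta>_def, rule exI[of _ \<epsilon>], intro conjI \<epsilon>0 allI impI, elim conjE)
    fix b p d d_in d_out q \<kappa> :: nat and \<beta>_B h :: real and L R :: "'a set"
    assume fin: "finite L" "finite R" and disj: "L \<inter> R = {}" and card: "card L = b" "card R = b"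
      and p: "p = b" and d: "4 + 1200 / \<rho> \<le> real d" "real d \<le> real b powr (1 - \<rho>)"
      and din: "d_in = nat \<lfloor>\<theta> * real d\<rfloor>" and dout: "d_out = d - nat \<lfloor>\<theta> * real d\<rfloor>"
      and \<kappa>: "\<kappa> \<in> {1..q}" and \<beta>B: "0 < \<beta>_B"
      and x: "0 \<le> 1 - (real q)\<^sup>2 * exp (2 * \<bar>h\<bar>) / exp (1 / 200 * \<beta>_B * real d)"
    let ?W = "L \<union> R"
    let ?x = "(real q)\<^sup>2 * exp (2 * \<bar>h\<bar>) / exp (1 / 200 * \<beta>_B * real d)"
    let ?H = "\<lambda>v i. h * of_bool (i = \<kappa>) * of_bool (v \<in> ?W)"
    let ?good = "{(P, E_B). \<forall>V E \<beta> \<tau>.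
       attached_via_ports ?W E_B P d_out V E \<and>
       (\<forall>e \<in> E_B. \<beta> e = \<beta>_B) \<and> (\<forall>e \<in> E - E_B. \<bar>\<beta> e\<bar> \<le> \<beta>_B) \<and>
       \<tau> \<in> configs (V - ?W) q
       \<longrightarrow>
       \<P>(\<sigma> in measure_pmf (potts q V E \<beta> ?H).
            \<exists>i \<in> {1..q}. restrict \<sigma> ?W = mono_config ?W i \<bar> restrict \<sigma> (V - ?W) = \<tau>)
       \<ge> (1 - ?x) ^ (2 * b)}"
    have "1200 / \<rho> > 1200" using assms by (simp add: field_simps)
    have n: "\<theta> * real d - 1 < real d_in" "real d_in \<le> \<theta> * real d"
      unfolding din using \<theta>_def by simp_all
    then have "d_in \<le> d" by (simp add: \<theta>_def)
    then have d_out: "real d_out = real d - real d_in" using din dout by simp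
    have n_ge: "1000 / \<rho> \<le> real d_in"
      using n d \<open>1200 / \<rho> > 1200\<close> by (simp add: \<theta>_def)
    have n_le: "real d_in \<le> real b powr (1 - \<rho>)" using n d by (simp add: \<theta>_def)
    have gap: "1 / 200 * real d \<le> real d_in / 50 / 2 - real d_out"
      using n d d_out \<open>1200 / \<rho> > 1200\<close> by (simp add: \<theta>_def)
    define y where "y = exp (\<bar>h\<bar> - \<beta>_B * (real d_in / 50 / 2 - real d_out))"
    have y0: "0 \<le> y" by (simp add: y_def)
    have q: "1 \<le> q" using \<kappa> by simp
    have "1 / 200 * \<beta>_B * real d = \<beta>_B * (1 / 200 * real d)" by simp
    also have "\<dots> \<le> \<beta>_B * (real d_in / 50 / 2 - real d_out)"
      by (rule mult_left_mono[OF gap]) (use \<beta>B in simp)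
    finally have "y \<le> exp (2 * \<bar>h\<bar> - 1 / 200 * \<beta>_B * real d)"
      unfolding y_def exp_le_cancel_iff by (intro diff_mono) auto
    \<comment> \<open>As \<open>q\<close> is at least 1, the factor \<open>q\<close> may be raised
      to its square; doubling the field term was possible because it is nonnegative.\<close>
    then have "real q * y \<le> (real q)\<^sup>2 * exp (2 * \<bar>h\<bar> - 1 / 200 * \<beta>_B * real d)"
      using q y0 by (intro mult_mono) (auto simp: power2_eq_square)
    then have qy: "real q * y \<le> ?x" by (simp add: exp_diff)
    \<comment> \<open>By assumption \<open>1 - ?x\<close> is nonnegative, so \<open>q * y\<close>
      may be replaced by \<open>?x\<close>, and the product is a difference of squares.\<close>
    have "(1 - ?x) * (1 + real q * y) \<le> (1 - ?x) * (1 + ?x)"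
      using x qy by (intro mult_left_mono) auto
    also have "\<dots> = 1 - ?x\<^sup>2" by (simp add: algebra_simps power2_eq_square)
    also have "\<dots> \<le> 1" by simp
    finally have base: "1 - ?x \<le> 1 / (1 + real q * y)"
      using y0 by (simp add: pos_le_divide_eq add_pos_nonneg)
    have cW: "card ?W = 2 * b" using fin disj card by (simp add: card_Un_disjoint)
    \<comment> \<open>In the case \<open>b = 0\<close> the power \<open>0 powr (1 - \<rho>)\<close>
      is 0 by convention, which contradicts the lower bound on \<open>d\<close>.\<close>
    have "b \<noteq> 0"
    proof
      assume "b = 0"
      then have "real d \<le> 0" using d by simp
      then show False using d \<open>1200 / \<rho> > 1200\<close> by linarith
    qed
    then have W: "?W \<noteq> {}" using card by auto
    have good: "(P, G) \<in> ?good" if ex: "edge_expanding ?W G (real d_in / 50)" for P G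
    proof (clarify)
      fix V E \<beta> \<tau>
      assume att: "attached_via_ports ?W G P d_out V E" and \<beta>in: "\<forall>e\<in>G. \<beta> e = \<beta>_B"
        and \<beta>out: "\<forall>e\<in>E - G. \<bar>\<beta> e\<bar> \<le> \<beta>_B" and \<tau>: "\<tau> \<in> configs (V - ?W) q"
      have V: "finite V" "?W \<subseteq> V"
        using att by (auto simp: attached_via_ports_def simple_graph_def induced_subgraph_def)
      have "(1 - ?x) ^ (2 * b) \<le> (1 / (1 + real q * y)) ^ (2 * b)"
        using base x by (intro power_mono)
      also have "\<dots> = 1 / (1 + real q * y) ^ card ?W" by (simp add: power_one_over cW)
      also have "\<dots> \<le> \<P>(\<sigma> in measure_pmf (potts q V E \<beta> ?H).
            \<exists>i \<in> {1..q}. restrict \<sigma> ?W = mono_config ?W i \<bar> restrict \<sigma> (V - ?W) = \<tau>)"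
      proof (rule cond_prob_potts_monochromatic_ge[OF V W q y0 \<tau>])
        fix \<sigma> assume \<sigma>: "\<sigma> \<in> configs V q"
        obtain i where "i \<in> {1..q}"
          "potts_weight V E \<beta> ?H \<sigma> \<le> potts_weight V E \<beta> ?H (\<lambda>v. if v \<in> ?W then i else \<sigma> v) *
             exp (\<bar>h\<bar> - \<beta>_B * (real d_in / 50 / 2 - real d_out)) ^ card {v \<in> ?W. \<sigma> v \<noteq> i}"
          by (rule potts_weight_le_monochromatic[OF att _ ex _ \<beta>B _ _ \<sigma> q refl, of \<beta> h \<kappa>])
            (use fin \<beta>in \<beta>out in auto)
        then show "\<exists>i\<in>{1..q}. potts_weight V E \<beta> ?H \<sigma> \<le>
            potts_weight V E \<beta> ?H (\<lambda>v. if v \<in> ?W then i else \<sigma> v) * y ^ card {v \<in> ?W. \<sigma> v \<noteq> i}"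
          unfolding y_def by blast
      qed
      finally show "(1 - ?x) ^ (2 * b) \<le> \<P>(\<sigma> in measure_pmf (potts q V E \<beta> ?H).
            \<exists>i \<in> {1..q}. restrict \<sigma> ?W = mono_config ?W i \<bar> restrict \<sigma> (V - ?W) = \<tau>)" .
    qed
    show "1 - \<epsilon> b \<le> measure_pmf.prob (random_port_graph L R p d_in d_out) ?good"
    proof (cases "3 \<le> b \<and> real b powr (- \<rho> / 4) \<le> 1 / 6")
      case True
      let ?Q = "Pi_pmf {..<d_in} {} (\<lambda>_. pmf_of_set (perfect_matchings L R))"
      have "1 - \<epsilon> b \<le> measure_pmf.prob ?Q {M. edge_expanding ?W (\<Union>k<d_in. M k) (real d_in / 50)}"
        using prob_edge_expanding[OF fin disj card assms _ _ n_ge n_le] True by (simp add: \<epsilon>_def)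
      also have "\<dots> \<le> measure_pmf.prob ?Q ((\<lambda>M. (?W, \<Union>k<d_in. M k)) -` ?good)"
      proof (rule measure_pmf.finite_measure_mono)
        show "{M. edge_expanding ?W (\<Union>k<d_in. M k) (real d_in / 50)}
          \<subseteq> (\<lambda>M. (?W, \<Union>k<d_in. M k)) -` ?good"
          by (intro subsetI vimageI2 good) (simp only: mem_Collect_eq)
      qed simp
      also have "\<dots> = measure_pmf.prob (random_port_graph L R p d_in d_out) ?good"
        unfolding p random_port_graph_all_ports[OF fin disj card] measure_map_pmf ..
      finally show ?thesis .
    next
      case False
      then have "\<epsilon> b = 1" by (simp only: \<epsilon>_def if_False)
      then show ?thesis by (simp only: diff_self measure_nonneg)
    qed
  qed
qed

end
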